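(* Let $(\mathfrak{g},[~,~]_\mathfrak{g},\alpha)$ and $(\mathfrak{h},[~,~]_\mathfrak{h},\beta)$ be two (multiplicative) Hom-Lie algebras over $\mathbf{k}$ and let $\diamond:\mathfrak{g}\times\mathfrak{h}\to\mathfrak{h}$ be a Hom-Lie algebra action. (i) For any $\lambda\in\mathbf{k}$, the triple $(C^\bullet_{\mathrm{Hom}}(\mathfrak{h},\mathfrak{g}),[~,~]_{\mathsf{D}}^\sim,\widetilde{d}_\lambda)$ is a differential graded Lie algebra. (ii) An element $R\in C^1_{\mathrm{Hom}}(\mathfrak{h},\mathfrak{g})$ is a Maurer-Cartan element of this differential graded Lie algebra if and only if $R:\mathfrak{h}\to\mathfrak{g}$ is a relative Rota-Baxter operator of weight $\lambda$ with respect to the Hom-Lie algebra action $\diamond$.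
   Context: All vector spaces and (multi)linear maps are over a field $\mathbf{k}$ of characteristic $0$. A (multiplicative) Hom-Lie algebra $(\mathfrak{g},[~,~],\alpha)$ is a vector space $\mathfrak{g}$ with a skew-symmetric bilinear map $[~,~]$ and a linear map $\alpha:\mathfrak{g}\to\mathfrak{g}$ such that $[\alpha(x),[y,z]]+[\alpha(y),[z,x]]+[\alpha(z),[x,y]]=0$ and $\alpha([x,y])=[\alpha(x),\alpha(y)]$. A Hom-Lie algebra action of $(\mathfrak{g},[~,~]_\mathfrak{g},\alpha)$ on $(\mathfrak{h},[~,~]_\mathfrak{h},\beta)$ is a bilinear map $\diamond:\mathfrak{g}\times\mathfrak{h}\to\mathfrak{h}$ such that for $x,y\in\mathfrak{g}$, $h,k\in\mathfrak{h}$: $\beta(x\diamond h)=\alpha(x)\diamond\beta(h)$; $[x,y]_\mathfrak{g}\diamond\beta(h)=\alpha(x)\diamond(y\diamond h)-\alpha(y)\diamond(x\diamond h)$; $\alpha(x)\diamond[h,k]_\mathfrak{h}=[x\diamond h,\beta(k)]_\mathfrak{h}+[\beta(h),x\diamond k]_\mathfrak{h}$. A linear map $R:\mathfrak{h}\to\mathfrak{g}$ is a relative Rota-Baxter operator of weight $\lambda$ if $\alpha\circ R=R\circ\beta$ and $[R(h),R(k)]_\mathfrak{g}=R\big(R(h)\diamond k-R(k)\diamond h+\lambda[h,k]_\mathfrak{h}\big)$ for all $h,k\in\mathfrak{h}$. For $n\ge1$, $C^n_{\mathrm{Hom}}(\mathfrak{h},\mathfrak{g})=\{f:\wedge^n\mathfrak{h}\to\mathfrak{g}\mid\alpha\circ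 f=f\circ\beta^{\wedge n}\}$, in degree $n$, $C^\bullet_{\mathrm{Hom}}(\mathfrak{h},\mathfrak{g})=\bigoplus_{n\ge1} C^n_{\mathrm{Hom}}(\mathfrak{h},\mathfrak{g})$; similarly $C^n_{\mathrm{Hom}}(\mathfrak{h},\mathfrak{h})=\{f:\wedge^n\mathfrak{h}\to\mathfrak{h}\mid\beta\circ f=f\circ\beta^{\wedge n}\}$. $Sh(m,n)$ is the set of $(m,n)$-shuffles. For $f\in C^m_{\mathrm{Hom}}(\mathfrak{h},\mathfrak{h})$ and $P\in C^n_{\mathrm{Hom}}(\mathfrak{h},\mathfrak{g})$ define $\widetilde{i}_fP\in C^{m+n-1}_{\mathrm{Hom}}(\mathfrak{h},\mathfrak{g})$ and $\widetilde\theta P\in C^{n+1}_{\mathrm{Hom}}(\mathfrak{h},\mathfrak{h})$ by $$(\widetilde{i}_fP)(h_1,\ldots,h_{m+n-1})=\sum_{\sigma\in Sh(m,n-1)}(-1)^\sigma P\big(f(h_{\sigma(1)},\ldots,h_{\sigma(m)}),\beta^{m-1}h_{\sigma(m+1)},\ldots,\beta^{m-1}h_{\sigma(m+n-1)}\big),$$ $$(\widetilde\theta P)(h_1,\ldots,h_{n+1})=\sum_{i=1}^{n+1}(-1)^{n+i}P(h_1,\ldots,\widehat{h_i},\ldots,h_{n+1})\diamond\beta^{n-1}(h_i).$$ For $P\in C^m_{\mathrm{Hom}}(\mathfrak{h},\mathfrak{g})$, $Q\in C^n_{\mathrm{Hom}}(\mathfrak{h},\mathfrak{g})$ the cup product bracket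 is $$[P,Q]_{\mathsf{C}}(h_1,\ldots,h_{m+n})=\sum_{\sigma\in Sh(m,n)}(-1)^\sigma[\alpha^{n-1}P(h_{\sigma(1)},\ldots,h_{\sigma(m)}),\alpha^{m-1}Q(h_{\sigma(m+1)},\ldots,h_{\sigma(m+n)})]_\mathfrak{g},$$ and the derived bracket is $[P,Q]_{\mathsf{D}}^\sim=[P,Q]_{\mathsf{C}}+\widetilde{i}_{\widetilde\theta P}Q-(-1)^{mn}\widetilde{i}_{\widetilde\theta Q}P$. The map $\widetilde{d}_\lambda:C^n_{\mathrm{Hom}}(\mathfrak{h},\mathfrak{g})\to C^{n+1}_{\mathrm{Hom}}(\mathfrak{h},\mathfrak{g})$ is $$(\widetilde{d}_\lambda f)(h_1,\ldots,h_{n+1})=\lambda\sum_{1\le i<j\le n+1}(-1)^{i+j}f([h_i,h_j]_\mathfrak{h},\beta(h_1),\ldots,\widehat{\beta(h_i)},\ldots,\widehat{\beta(h_j)},\ldots,\beta(h_{n+1})).$$ A Maurer-Cartan element of a differential graded Lie algebra $(\mathcal{L},[~,~],d)$ is $s\in\mathcal{L}^1$ with $ds+\frac12[s,s]=0$. *)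

theory Defs
  imports Complex_Main "HOL-Library.Function_Algebras" "HOL-Combinatorics.Permutations"
begin

section \<open>Hom-Lie algebras, actions and relative Rota-Baxter operators\<close>

text \<open>
  A vector space over the field \<open>'k\<close> is a whole type together with a scalar multiplication
  satisfying the library locale \<open>vector_space\<close>; no dimension is bounded.
\<close>

definition bilinear_map ::
  "('k::field \<Rightarrow> 'a::ab_group_add \<Rightarrow> 'a) \<Rightarrow> ('k \<Rightarrow> 'b::ab_group_add \<Rightarrow> 'b)
    \<Rightarrow> ('k \<Rightarrow> 'c::ab_group_add \<Rightarrow> 'c) \<Rightarrow> ('a \<Rightarrow> 'b \<Rightarrow> 'c) \<Rightarrow> bool" where
  "bilinear_map s1 s2 s3 f \<longleftrightarrow>
     (\<forall>x. Vector_Spaces.linear s2 s3 (\<lambda>y. f x y)) \<and>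
     (\<forall>y. Vector_Spaces.linear s1 s3 (\<lambda>x. f x y))"

locale hom_lie_algebra = vector_space scale
  for scale :: "'k::field_char_0 \<Rightarrow> 'v::ab_group_add \<Rightarrow> 'v" +
  fixes bracket :: "'v \<Rightarrow> 'v \<Rightarrow> 'v" and \<alpha> :: "'v \<Rightarrow> 'v"
  assumes bilinear_bracket: "bilinear_map scale scale scale bracket"
    and skew: "bracket x y = - bracket y x"
    and linear_twist: "Vector_Spaces.linear scale scale \<alpha>"
    and hom_jacobi:
      "bracket (\<alpha> x) (bracket y z) + bracket (\<alpha> y) (bracket z x) + bracket (\<alpha> z) (bracket x y) = 0"
    and multiplicative: "\<alpha> (bracket x y) = bracket (\<alpha> x) (\<alpha> y)"

locale hom_lie_action =
  g: hom_lie_algebra scaleG brG \<alpha> + h: hom_lie_algebra scaleH brH \<beta>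
  for scaleG :: "'k::field_char_0 \<Rightarrow> 'g::ab_group_add \<Rightarrow> 'g"
    and brG :: "'g \<Rightarrow> 'g \<Rightarrow> 'g" and \<alpha> :: "'g \<Rightarrow> 'g"
    and scaleH :: "'k \<Rightarrow> 'h::ab_group_add \<Rightarrow> 'h"
    and brH :: "'h \<Rightarrow> 'h \<Rightarrow> 'h" and \<beta> :: "'h \<Rightarrow> 'h" +
  fixes act :: "'g \<Rightarrow> 'h \<Rightarrow> 'h"
  assumes bilinear_act: "bilinear_map scaleG scaleH scaleH act"
    and act_twist: "\<beta> (act x h) = act (\<alpha> x) (\<beta> h)"
    and act_bracket:
      "act (brG x y) (\<beta> h) = act (\<alpha> x) (act y h) - act (\<alpha> y) (act x h)"
    and act_derivation:
      "act (\<alpha> x) (brH h k) = brH (act x h) (\<beta> k) + brH (\<beta> h) (act x k)"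

definition relative_rota_baxter ::
  "('k::field_char_0 \<Rightarrow> 'g::ab_group_add \<Rightarrow> 'g) \<Rightarrow> ('g \<Rightarrow> 'g \<Rightarrow> 'g) \<Rightarrow> ('g \<Rightarrow> 'g)
    \<Rightarrow> ('k \<Rightarrow> 'h::ab_group_add \<Rightarrow> 'h) \<Rightarrow> ('h \<Rightarrow> 'h \<Rightarrow> 'h) \<Rightarrow> ('h \<Rightarrow> 'h)
    \<Rightarrow> ('g \<Rightarrow> 'h \<Rightarrow> 'h) \<Rightarrow> 'k \<Rightarrow> ('h \<Rightarrow> 'g) \<Rightarrow> bool" where
  "relative_rota_baxter scaleG brG \<alpha> scaleH brH \<beta> act lam R \<longleftrightarrow>
     Vector_Spaces.linear scaleH scaleG R \<and>
     \<alpha> \<circ> R = R \<circ> \<beta> \<and>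
     (\<forall>h k. brG (R h) (R k) = R (act (R h) k - act (R k) h + scaleH lam (brH h k)))"


section \<open>Differential graded Lie algebras\<close>

text \<open>
  The grading is by natural numbers, which suffices for complexes in positive degrees.
  The graded vector space is the internal direct sum of the subspaces \<open>L n\<close>, so its underlying
  space is \<open>span (\<Union>n. L n)\<close>; \<open>bracket\<close> and \<open>d\<close> are only constrained there.
\<close>

locale dg_lie_algebra = vector_space scale
  for scale :: "'k::field_char_0 \<Rightarrow> 'v::ab_group_add \<Rightarrow> 'v" +
  fixes L :: "nat \<Rightarrow> 'v set"
    and bracket :: "'v \<Rightarrow> 'v \<Rightarrow> 'v"
    and d :: "'v \<Rightarrow> 'v"
  assumes subspace_L: "subspace (L n)"
    and direct_sum:
      "\<lbrakk>finite A; \<forall>n\<in>A. u n \<in> L n; (\<Sum>n\<in>A. u n) = 0\<rbrakk> \<Longrightarrow> \<forall>n\<in>A. u n = 0"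
    and bracket_add_left:
      "\<lbrakk>x \<in> span (\<Union>n. L n); y \<in> span (\<Union>n. L n); z \<in> span (\<Union>n. L n)\<rbrakk>
        \<Longrightarrow> bracket (x + y) z = bracket x z + bracket y z"
    and bracket_add_right:
      "\<lbrakk>x \<in> span (\<Union>n. L n); y \<in> span (\<Union>n. L n); z \<in> span (\<Union>n. L n)\<rbrakk>
        \<Longrightarrow> bracket x (y + z) = bracket x y + bracket x z"
    and bracket_scale_left:
      "\<lbrakk>x \<in> span (\<Union>n. L n); y \<in> span (\<Union>n. L n)\<rbrakk>
        \<Longrightarrow> bracket (scale c x) y = scale c (bracket x y)"
    and bracket_scale_right:
      "\<lbrakk>x \<in> span (\<Union>n. L n); y \<in> span (\<Union>n. L n)\<rbrakk>
        \<Longrightarrow> bracket x (scale c y) = scale c (bracket x y)"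
    and d_add:
      "\<lbrakk>x \<in> span (\<Union>n. L n); y \<in> span (\<Union>n. L n)\<rbrakk> \<Longrightarrow> d (x + y) = d x + d y"
    and d_scale: "x \<in> span (\<Union>n. L n) \<Longrightarrow> d (scale c x) = scale c (d x)"
    and bracket_degree: "\<lbrakk>x \<in> L m; y \<in> L n\<rbrakk> \<Longrightarrow> bracket x y \<in> L (m + n)"
    and graded_skew:
      "\<lbrakk>x \<in> L m; y \<in> L n\<rbrakk> \<Longrightarrow> bracket x y = - scale ((-1) ^ (m * n)) (bracket y x)"
    and graded_jacobi:
      "\<lbrakk>x \<in> L m; y \<in> L n; z \<in> L p\<rbrakk> \<Longrightarrow>
        bracket x (bracket y z) =
          bracket (bracket x y) z + scale ((-1) ^ (m * n)) (bracket y (bracket x z))"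
    and d_degree: "x \<in> L n \<Longrightarrow> d x \<in> L (Suc n)"
    and d_square: "x \<in> L n \<Longrightarrow> d (d x) = 0"
    and d_derivation:
      "\<lbrakk>x \<in> L m; y \<in> L n\<rbrakk> \<Longrightarrow>
        d (bracket x y) = bracket (d x) y + scale ((-1) ^ m) (bracket x (d y))"

definition maurer_cartan ::
  "('k::field_char_0 \<Rightarrow> 'v::ab_group_add \<Rightarrow> 'v) \<Rightarrow> (nat \<Rightarrow> 'v set) \<Rightarrow> ('v \<Rightarrow> 'v \<Rightarrow> 'v)
    \<Rightarrow> ('v \<Rightarrow> 'v) \<Rightarrow> 'v \<Rightarrow> bool" where
  "maurer_cartan scale L bracket d s \<longleftrightarrow> s \<in> L 1 \<and> d s + scale (1/2) (bracket s s) = 0"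


section \<open>Cochains\<close>

text \<open>
  A linear map on the \<open>n\<close>-th exterior power is represented by the corresponding alternating
  \<open>n\<close>-linear map, as a function on argument lists that vanishes on lists of any other length.
  The type \<open>'h list \<Rightarrow> 'g\<close> thus contains the cochains of all degrees, as well as their direct
  sum; addition is pointwise. Lists are indexed from \<open>0\<close>: the argument \<open>h\<^sub>i\<close> of the usual
  notation is the entry \<open>hs ! (i - 1)\<close>.
\<close>

definition alternating_multilinear ::
  "('k::field \<Rightarrow> 'h::ab_group_add \<Rightarrow> 'h) \<Rightarrow> ('k \<Rightarrow> 'g::ab_group_add \<Rightarrow> 'g) \<Rightarrow> nat
    \<Rightarrow> ('h list \<Rightarrow> 'g) \<Rightarrow> bool" where
  "alternating_multilinear scaleH scaleG n f \<longleftrightarrow>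
     (\<forall>hs. length hs \<noteq> n \<longrightarrow> f hs = 0) \<and>
     (\<forall>hs i. length hs = n \<and> i < n \<longrightarrow>
        Vector_Spaces.linear scaleH scaleG (\<lambda>v. f (hs[i := v]))) \<and>
     (\<forall>hs i j. length hs = n \<and> i < j \<and> j < n \<and> hs ! i = hs ! j \<longrightarrow> f hs = 0)"

definition hom_cochains ::
  "('k::field_char_0 \<Rightarrow> 'h::ab_group_add \<Rightarrow> 'h) \<Rightarrow> ('h \<Rightarrow> 'h)
    \<Rightarrow> ('k \<Rightarrow> 'g::ab_group_add \<Rightarrow> 'g) \<Rightarrow> ('g \<Rightarrow> 'g) \<Rightarrow> nat \<Rightarrow> ('h list \<Rightarrow> 'g) set" where
  "hom_cochains scaleH \<beta> scaleG \<alpha> n =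
     (if n = 0 then {0}
      else {f. alternating_multilinear scaleH scaleG n f \<and> (\<forall>hs. \<alpha> (f hs) = f (map \<beta> hs))})"

definition cochain_scale :: "('k \<Rightarrow> 'g \<Rightarrow> 'g) \<Rightarrow> 'k \<Rightarrow> ('h list \<Rightarrow> 'g) \<Rightarrow> 'h list \<Rightarrow> 'g" where
  "cochain_scale scaleG c f = (\<lambda>hs. scaleG c (f hs))"

definition shuffles_perm :: "nat \<Rightarrow> nat \<Rightarrow> (nat \<Rightarrow> nat) set" where
  "shuffles_perm m n =
     {\<sigma>. \<sigma> permutes {..<m + n} \<and> strict_mono_on {..<m} \<sigma> \<and> strict_mono_on {m..<m + n} \<sigma>}"


section \<open>The operations on homogeneous cochains\<close>

text \<open>
  The parameters \<open>m\<close> and \<open>n\<close> are the degrees of the cochain arguments and are meant to be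
  positive. Where the usual formula has an index \<open>i\<close> starting from \<open>1\<close>, the sums below run over
  \<open>i - 1\<close>.
\<close>

definition insertion ::
  "('k::field_char_0 \<Rightarrow> 'g::ab_group_add \<Rightarrow> 'g) \<Rightarrow> ('h \<Rightarrow> 'h) \<Rightarrow> nat \<Rightarrow> nat
    \<Rightarrow> ('h list \<Rightarrow> 'h) \<Rightarrow> ('h list \<Rightarrow> 'g) \<Rightarrow> 'h list \<Rightarrow> 'g" where
  "insertion scaleG \<beta> m n f P hs =
     (if length hs = m + n - 1
      then \<Sum>\<sigma>\<in>shuffles_perm m (n - 1).
             scaleG (of_int (sign \<sigma>))
               (P (f (map (\<lambda>i. hs ! \<sigma> i) [0..<m])
                   # map (\<lambda>i. (\<beta> ^^ (m - 1)) (hs ! \<sigma> i)) [m..<m + n - 1]))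
      else 0)"

definition theta ::
  "('k::field_char_0 \<Rightarrow> 'h::ab_group_add \<Rightarrow> 'h) \<Rightarrow> ('h \<Rightarrow> 'h) \<Rightarrow> ('g \<Rightarrow> 'h \<Rightarrow> 'h) \<Rightarrow> nat
    \<Rightarrow> ('h list \<Rightarrow> 'g) \<Rightarrow> 'h list \<Rightarrow> 'h" where
  "theta scaleH \<beta> act n P hs =
     (if length hs = n + 1
      then \<Sum>i<n + 1. scaleH ((-1) ^ (n + (i + 1)))
             (act (P (nths hs (- {i}))) ((\<beta> ^^ (n - 1)) (hs ! i)))
      else 0)"

definition cup_bracket ::
  "('k::field_char_0 \<Rightarrow> 'g::ab_group_add \<Rightarrow> 'g) \<Rightarrow> ('g \<Rightarrow> 'g \<Rightarrow> 'g) \<Rightarrow> ('g \<Rightarrow> 'g)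
    \<Rightarrow> nat \<Rightarrow> nat \<Rightarrow> ('h list \<Rightarrow> 'g) \<Rightarrow> ('h list \<Rightarrow> 'g) \<Rightarrow> 'h list \<Rightarrow> 'g" where
  "cup_bracket scaleG brG \<alpha> m n P Q hs =
     (if length hs = m + n
      then \<Sum>\<sigma>\<in>shuffles_perm m n.
             scaleG (of_int (sign \<sigma>))
               (brG ((\<alpha> ^^ (n - 1)) (P (map (\<lambda>i. hs ! \<sigma> i) [0..<m])))
                    ((\<alpha> ^^ (m - 1)) (Q (map (\<lambda>i. hs ! \<sigma> i) [m..<m + n]))))
      else 0)"

definition homogeneous_derived_bracket ::
  "('k::field_char_0 \<Rightarrow> 'g::ab_group_add \<Rightarrow> 'g) \<Rightarrow> ('g \<Rightarrow> 'g \<Rightarrow> 'g) \<Rightarrow> ('g \<Rightarrow> 'g)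
    \<Rightarrow> ('k \<Rightarrow> 'h::ab_group_add \<Rightarrow> 'h) \<Rightarrow> ('h \<Rightarrow> 'h) \<Rightarrow> ('g \<Rightarrow> 'h \<Rightarrow> 'h)
    \<Rightarrow> nat \<Rightarrow> nat \<Rightarrow> ('h list \<Rightarrow> 'g) \<Rightarrow> ('h list \<Rightarrow> 'g) \<Rightarrow> 'h list \<Rightarrow> 'g" where
  "homogeneous_derived_bracket scaleG brG \<alpha> scaleH \<beta> act m n P Q =
     cup_bracket scaleG brG \<alpha> m n P Q
     + insertion scaleG \<beta> (m + 1) n (theta scaleH \<beta> act m P) Q
     - cochain_scale scaleG ((-1) ^ (m * n))
         (insertion scaleG \<beta> (n + 1) m (theta scaleH \<beta> act n Q) P)"

definition homogeneous_differential ::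
  "('k::field_char_0 \<Rightarrow> 'g::ab_group_add \<Rightarrow> 'g) \<Rightarrow> ('h \<Rightarrow> 'h \<Rightarrow> 'h) \<Rightarrow> ('h \<Rightarrow> 'h) \<Rightarrow> 'k
    \<Rightarrow> nat \<Rightarrow> ('h list \<Rightarrow> 'g) \<Rightarrow> 'h list \<Rightarrow> 'g" where
  "homogeneous_differential scaleG brH \<beta> lam n f hs =
     (if length hs = n + 1
      then scaleG lam (\<Sum>j<n + 1. \<Sum>i<j.
             scaleG ((-1) ^ ((i + 1) + (j + 1)))
               (f (brH (hs ! i) (hs ! j) # map \<beta> (nths hs (- {i, j})))))
      else 0)"


section \<open>Extension to the direct sum\<close>

definition component :: "nat \<Rightarrow> ('h list \<Rightarrow> 'g::zero) \<Rightarrow> 'h list \<Rightarrow> 'g" where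
  "component n P = (\<lambda>hs. if length hs = n then P hs else 0)"

text \<open>
  The bracket of \<open>P\<close> and \<open>Q\<close> is the sum over all \<open>m, n \<ge> 1\<close> of the brackets of the degree \<open>m\<close>
  component of \<open>P\<close> and the degree \<open>n\<close> component of \<open>Q\<close>. On a list \<open>hs\<close> only the terms with
  \<open>m + n = length hs\<close> contribute, so the sum is finite at every list.
\<close>

definition derived_bracket ::
  "('k::field_char_0 \<Rightarrow> 'g::ab_group_add \<Rightarrow> 'g) \<Rightarrow> ('g \<Rightarrow> 'g \<Rightarrow> 'g) \<Rightarrow> ('g \<Rightarrow> 'g)
    \<Rightarrow> ('k \<Rightarrow> 'h::ab_group_add \<Rightarrow> 'h) \<Rightarrow> ('h \<Rightarrow> 'h) \<Rightarrow> ('g \<Rightarrow> 'h \<Rightarrow> 'h)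
    \<Rightarrow> ('h list \<Rightarrow> 'g) \<Rightarrow> ('h list \<Rightarrow> 'g) \<Rightarrow> 'h list \<Rightarrow> 'g" where
  "derived_bracket scaleG brG \<alpha> scaleH \<beta> act P Q hs =
     (\<Sum>m\<in>{1..<length hs}.
        homogeneous_derived_bracket scaleG brG \<alpha> scaleH \<beta> act m (length hs - m)
          (component m P) (component (length hs - m) Q) hs)"

definition differential ::
  "('k::field_char_0 \<Rightarrow> 'g::ab_group_add \<Rightarrow> 'g) \<Rightarrow> ('h \<Rightarrow> 'h \<Rightarrow> 'h) \<Rightarrow> ('h \<Rightarrow> 'h) \<Rightarrow> 'k
    \<Rightarrow> ('h list \<Rightarrow> 'g) \<Rightarrow> 'h list \<Rightarrow> 'g" where
  "differential scaleG brH \<beta> lam f hs =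
     (if 2 \<le> length hs
      then homogeneous_differential scaleG brH \<beta> lam (length hs - 1)
             (component (length hs - 1) f) hs
      else 0)"

end

theory Submission
  imports Defs "HOL-Library.Product_Plus"
begin

text \<open>
  The bracket of the theorem is a derived bracket, and all its axioms come from one larger graded
  Lie algebra. Let \<open>V = \<gg> \<times> \<hh>\<close> with the twist \<open>\<gamma> = \<alpha> \<times> \<beta>\<close>. The Hom-cochains on \<open>V\<close> with values in
  \<open>V\<close>, an \<open>(n + 1)\<close>-ary cochain having degree \<open>n\<close>, carry the composition
  \<open>(f \<circ> g)(v\<^sub>1, \<dots>) = \<Sum> \<plusminus> f (g (v\<^sub>\<sigma>\<^sub>1, \<dots>, v\<^sub>\<sigma>\<^sub>k), \<gamma>\<^bsup>k - 1\<^esup> v, \<dots>)\<close>. Its associator is graded symmetric in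
  the last two arguments (\<open>circ_circ\<close>, \<open>circ_assoc_symmetric\<close>), so its graded commutator, the
  Nijenhuis-Richardson bracket, satisfies the graded Jacobi identity (\<open>nr_jacobi\<close>).

  Three binary cochain identities hold in it. The semidirect product \<open>\<pi>\<close> of \<open>\<gg>\<close> with the
  representation \<open>\<hh>\<close>, forgetting the bracket of \<open>\<hh>\<close>, satisfies \<open>[\<pi>, \<pi>] = 0\<close>; the bracket \<open>\<mu>\<close> of \<open>\<hh>\<close>,
  multiplied by the weight, satisfies \<open>[\<mu>, \<mu>] = 0\<close>; and \<open>[\<mu>, \<pi>] = 0\<close> because \<open>\<gg>\<close> acts by derivations.
  A cochain from \<open>\<hh>\<close> to \<open>\<gg>\<close> extends by zero to \<open>V\<close>. Two such extensions commute, since neither can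
  take a value of the other as an argument. Hence \<open>\<plusminus>[[\<pi>, P], Q]\<close> is a graded Lie bracket on these
  cochains for the degree given by the arity, and \<open>\<plusminus>[\<mu>, \<cdot>]\<close> is a differential for it. This part is
  formal and takes place in the locale \<open>graded_lie_ring\<close>.

  Expanding the double bracket leaves three kinds of terms: the pairing \<open>[P, Q]\<^sub>\<gg>\<close> is the cup product
  bracket, and inserting \<open>\<pi>(P, \<cdot>)\<close> into \<open>Q\<close>, or \<open>\<pi>(Q, \<cdot>)\<close> into \<open>P\<close>, gives the two insertions along \<open>\<theta>\<close>.
  With arities \<open>p + 1\<close> and \<open>q + 1\<close> the result is that the bracket is \<open>(-1)\<^bsup>(p+1)q\<^esup> [[\<pi>, P], Q]\<close>
  (\<open>derived_hat\<close>) and the differential is \<open>(-1)\<^bsup>p\<^esup> [\<mu>, P]\<close> (\<open>codifferential_hat\<close>).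

  Sums over shuffles are treated as the sum over all ways to distribute a list over two lists,
  defined by recursion on the list. Coassociativity, graded cocommutativity and compatibility with
  concatenation of this unshuffle coproduct are then list inductions, and they carry all
  combinatorics above. The comparison with shuffle permutations is made once, in
  \<open>sum_shuffles_perm_eq_unshuffle_sum\<close>.

  The Maurer-Cartan equation of a degree one element is an identity between cochains of arity two.
  Evaluated at a pair \<open>[h, k]\<close> it is the Rota-Baxter identity.
\<close>

section \<open>Signed sums over unshuffles\<close>

text \<open>
  Multiplication by \<open>(-1)\<^bsup>k\<^esup>\<close> in an abelian group, so that the sign calculus needs no scalars and
  reduces to parities.
\<close>

definition signed :: "nat \<Rightarrow> 'a::ab_group_add \<Rightarrow> 'a" where
  "signed k x = (if even k then x else - x)"

lemma signed_0 [simp]: "signed 0 x = x"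
  and signed_Suc [simp]: "signed (Suc k) x = - signed k x"
  and signed_zero [simp]: "signed k 0 = 0"
  and signed_minus [simp]: "signed k (- x) = - signed k x"
  and signed_signed [simp]: "signed k (signed l x) = signed (k + l) x"
  and signed_add: "signed k (x + y) = signed k x + signed k y"
  by (auto simp: signed_def)

text \<open>
  The unshuffle coproduct of the exterior coalgebra, paired with \<open>F\<close>: the sum of \<open>\<plusminus>F a b\<close> over all
  pairs of complementary subsequences \<open>a\<close>, \<open>b\<close>. Moving \<open>x\<close> from the front of the list to the front of
  \<open>b\<close> carries it past all of \<open>a\<close>, whence the sign. The lengths of \<open>a\<close> and \<open>b\<close> are not prescribed:
  cochains vanish on lists of the wrong length and select the right terms.
\<close>

fun unshuffle_sum :: "'a list \<Rightarrow> ('a list \<Rightarrow> 'a list \<Rightarrow> 'v::ab_group_add) \<Rightarrow> 'v" where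
  "unshuffle_sum [] F = F [] []"
| "unshuffle_sum (x # xs) F =
     unshuffle_sum xs (\<lambda>a b. F (x # a) b) + unshuffle_sum xs (\<lambda>a b. signed (length a) (F a (x # b)))"

lemma unshuffle_sum_cong:
  assumes "\<And>a b. length a + length b = length xs \<Longrightarrow> F a b = G a b"
  shows "unshuffle_sum xs F = unshuffle_sum xs G"
  using assms
proof (induction xs arbitrary: F G)
  case (Cons x xs)
  have "unshuffle_sum xs (\<lambda>a b. F (x # a) b) = unshuffle_sum xs (\<lambda>a b. G (x # a) b)"
    by (rule Cons.IH) (simp add: Cons.prems)
  moreover have "unshuffle_sum xs (\<lambda>a b. signed (length a) (F a (x # b)))
      = unshuffle_sum xs (\<lambda>a b. signed (length a) (G a (x # b)))"
    by (rule Cons.IH) (simp add: Cons.prems)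
  ultimately show ?case by simp
qed simp

lemma unshuffle_sum_zero [simp]: "unshuffle_sum xs (\<lambda>a b. 0) = 0"
  by (induction xs) auto

lemma unshuffle_sum_add:
  "unshuffle_sum xs (\<lambda>a b. F a b + G a b) = unshuffle_sum xs F + unshuffle_sum xs G"
  by (induction xs arbitrary: F G) (auto simp: signed_add)

lemma unshuffle_sum_additive:
  assumes "\<And>x y. T (x + y) = T x + T y"
  shows "T (unshuffle_sum xs F) = unshuffle_sum xs (\<lambda>a b. T (F a b))"
proof (induction xs arbitrary: F)
  case (Cons x xs)
  have "T 0 = 0" using assms[of 0 0] by simp
  then have "T (- x) = - T x" for x
    using assms[of x "- x"] by (simp add: add_eq_0_iff)
  then have "T (signed k x) = signed k (T x)" for k x
    by (simp add: signed_def)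
  then show ?case by (simp add: Cons.IH assms)
qed simp

lemma unshuffle_sum_minus:
  "unshuffle_sum xs (\<lambda>a b. - F a b) = - unshuffle_sum xs F"
  by (rule unshuffle_sum_additive[symmetric]) simp

lemma unshuffle_sum_signed:
  "unshuffle_sum xs (\<lambda>a b. signed k (F a b)) = signed k (unshuffle_sum xs F)"
  by (rule unshuffle_sum_additive[symmetric]) (simp add: signed_add)

lemma unshuffle_sum_map:
  "unshuffle_sum (map f xs) F = unshuffle_sum xs (\<lambda>a b. F (map f a) (map f b))"
  by (induction xs arbitrary: F) auto

text \<open>
  Coassociativity: both sides run over the distributions of the list over three lists. The first
  entry goes to \<open>c\<close> with sign \<open>(-1)\<^bsup>|u|\<^esup>\<close> on the left and \<open>(-1)\<^bsup>|a| + |b|\<^esup>\<close> on the right, and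
  \<open>|u| = |a| + |b|\<close>.
\<close>

lemma unshuffle_sum_assoc:
  "unshuffle_sum xs (\<lambda>u c. unshuffle_sum u (\<lambda>a b. F a b c))
   = unshuffle_sum xs (\<lambda>a u. unshuffle_sum u (\<lambda>b c. F a b c))"
proof (induction xs arbitrary: F)
  case (Cons x xs)
  have "unshuffle_sum xs (\<lambda>u c. signed (length u) (unshuffle_sum u (\<lambda>a b. F a b (x # c))))
    = unshuffle_sum xs (\<lambda>u c. unshuffle_sum u (\<lambda>a b. signed (length a + length b) (F a b (x # c))))"
    by (intro unshuffle_sum_cong)
      (auto simp flip: unshuffle_sum_signed intro!: unshuffle_sum_cong)
  moreover have "\<And>u c. unshuffle_sum u (\<lambda>a b. signed (length a) (signed (length b) (F a b (x # c))))
    = unshuffle_sum u (\<lambda>a b. signed (length a + length b) (F a b (x # c)))"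
    by simp
  ultimately show ?case
    by (simp add: Cons.IH unshuffle_sum_add signed_add algebra_simps flip: unshuffle_sum_signed)
qed simp

text \<open>Graded cocommutativity: interchanging the two blocks has sign \<open>(-1)\<^bsup>|a||b|\<^esup>\<close>.\<close>

lemma unshuffle_sum_commute:
  "unshuffle_sum xs F = unshuffle_sum xs (\<lambda>a b. signed (length a * length b) (F b a))"
proof (induction xs arbitrary: F)
  case (Cons x xs)
  show ?case
    unfolding unshuffle_sum.simps
    apply (subst (1) Cons.IH, subst (2) Cons.IH)
    apply (simp add: add.commute)
    apply (rule unshuffle_sum_cong)
    apply (auto simp: signed_def)
    done
qed simp

text \<open>
  The coproduct is multiplicative for concatenation. This is how a single slot of a long argument
  list is isolated below.
\<close>

lemma unshuffle_sum_append:
  "unshuffle_sum (xs @ ys) F = unshuffle_sum xs (\<lambda>a b. unshuffle_sum ys (\<lambda>c d.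
     signed (length b * length c) (F (a @ c) (b @ d))))"
proof (induction xs arbitrary: F)
  case (Cons x xs)
  show ?case
    apply (simp add: Cons.IH flip: unshuffle_sum_signed)
    apply (rule unshuffle_sum_cong)
    apply (rule unshuffle_sum_cong)
    apply (auto simp: signed_def)
    done
qed simp

lemma unshuffle_sum_slot_add:
  assumes "\<And>a b c. F (a @ (x + y) # b) c = F (a @ x # b) c + F (a @ y # b) c"
    and "\<And>a b c. F c (a @ (x + y) # b) = F c (a @ x # b) + F c (a @ y # b)"
  shows "unshuffle_sum (as @ (x + y) # bs) F
    = unshuffle_sum (as @ x # bs) F + unshuffle_sum (as @ y # bs) F"
  by (simp add: unshuffle_sum_append assms signed_add unshuffle_sum_add algebra_simps)

lemma unshuffle_sum_slot_additive:
  assumes "\<And>a b c. F (a @ y # b) c = T (F (a @ x # b) c)"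
    and "\<And>a b c. F c (a @ y # b) = T (F c (a @ x # b))"
    and T: "\<And>x y. T (x + y) = T x + T y"
  shows "unshuffle_sum (as @ y # bs) F = T (unshuffle_sum (as @ x # bs) F)"
proof -
  have "T 0 = 0" using T[of 0 0] by simp
  then have "T (- x) = - T x" for x
    using T[of x "- x"] by (simp add: add_eq_0_iff)
  then have "signed k (T x) = T (signed k x)" for k x
    by (simp add: signed_def)
  then show ?thesis
    by (simp add: unshuffle_sum_append assms unshuffle_sum_additive[of T])
qed

text \<open>
  The two terms that separate equal neighbours differ by one transposition and cancel.
\<close>

lemma unshuffle_sum_repeated:
  "unshuffle_sum (x # x # bs) F
   = unshuffle_sum bs (\<lambda>a b. F (x # x # a) b + F a (x # x # b))"
proof -
  have "unshuffle_sum (x # x # bs) F = unshuffle_sum bs (\<lambda>a b. F (x # x # a) b)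
    + unshuffle_sum bs (\<lambda>a b. signed (length a + length a) (F a (x # x # b)))"
    by (simp add: unshuffle_sum_minus)
  \<comment> \<open>Both copies of \<open>x\<close> pass \<open>a\<close>, an even number of transpositions in total.\<close>
  also have "(\<lambda>a b. signed (length a + length a) (F a (x # x # b))) = (\<lambda>a b. F a (x # x # b))"
    by (intro ext) (simp add: signed_def)
  finally show ?thesis by (simp add: unshuffle_sum_add)
qed

lemma unshuffle_sum_alternating:
  assumes "\<And>a b c. F (a @ x # x # b) c = 0" and "\<And>a b c. F c (a @ x # x # b) = 0"
  shows "unshuffle_sum (as @ x # x # bs) F = 0"
  unfolding unshuffle_sum_append unshuffle_sum_repeated by (simp add: assms)

section \<open>Alternating maps through adjacent entries\<close>

lemma adjacent_swap:
  fixes f :: "'v::ab_group_add list \<Rightarrow> 'w::ab_group_add"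
  assumes add: "\<And>as x y bs. f (as @ (x + y) # bs) = f (as @ x # bs) + f (as @ y # bs)"
    and alt: "\<And>as x bs. f (as @ x # x # bs) = 0"
  shows "f (as @ x # y # bs) = - f (as @ y # x # bs)"
proof -
  have "0 = f (as @ (x + y) # (x + y) # bs)" by (simp only: alt)
  also have "\<dots> = f (as @ x # (x + y) # bs) + f (as @ y # (x + y) # bs)"
    by (rule add)
  also have "f (as @ x # (x + y) # bs) = f (as @ x # x # bs) + f (as @ x # y # bs)"
    using add[of "as @ [x]"] by simp
  also have "f (as @ y # (x + y) # bs) = f (as @ y # x # bs) + f (as @ y # y # bs)"
    using add[of "as @ [y]"] by simp
  finally show ?thesis by (simp add: alt eq_neg_iff_add_eq_0)
qed

text \<open>
  Adjacent swaps move the two equal entries next to each other. Alternation only has to be checked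
  on neighbours, which is the form that passes to unshuffle sums.
\<close>

lemma alternating_of_adjacent:
  fixes f :: "'v::ab_group_add list \<Rightarrow> 'w::ab_group_add"
  assumes add: "\<And>as x y bs. f (as @ (x + y) # bs) = f (as @ x # bs) + f (as @ y # bs)"
    and alt: "\<And>as x bs. f (as @ x # x # bs) = 0"
  shows "f (as @ x # ms @ x # bs) = 0"
proof (induction ms arbitrary: as)
  case Nil
  show ?case by (simp add: alt)
next
  case (Cons m ms)
  have "f (as @ x # m # ms @ x # bs) = - f (as @ m # x # ms @ x # bs)"
    by (rule adjacent_swap) (fact add alt)+
  also have "f (as @ m # x # ms @ x # bs) = 0"
    using Cons.IH[of "as @ [m]"] by simp
  finally show ?case by simp
qed

text \<open>
  The slots of a cochain in terms of concatenation instead of indices. No condition on the length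
  of the list is left, because cochains vanish on lists of any other length.
\<close>

lemma hom_cochains_Suc_iff:
  assumes "vector_space s1" "vector_space s2"
  shows "f \<in> hom_cochains s1 \<beta> s2 \<alpha> (Suc n) \<longleftrightarrow>
     (\<forall>hs. length hs \<noteq> Suc n \<longrightarrow> f hs = 0) \<and>
     (\<forall>as x y bs. f (as @ (x + y) # bs) = f (as @ x # bs) + f (as @ y # bs)) \<and>
     (\<forall>as c x bs. f (as @ s1 c x # bs) = s2 c (f (as @ x # bs))) \<and>
     (\<forall>as x bs. f (as @ x # x # bs) = 0) \<and>
     (\<forall>hs. \<alpha> (f hs) = f (map \<beta> hs))"
    (is "?L \<longleftrightarrow> ?len \<and> ?add \<and> ?scale \<and> ?alt \<and> ?hom")
proof
  interpret s2: vector_space s2 by fact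
  assume f: ?L
  then have len: ?len and hom: ?hom
    and lin: "\<And>hs i. length hs = Suc n \<Longrightarrow> i < Suc n \<Longrightarrow>
        Vector_Spaces.linear s1 s2 (\<lambda>v. f (hs[i := v]))"
    and alt: "\<And>hs i j. length hs = Suc n \<Longrightarrow> i < j \<Longrightarrow> j < Suc n \<Longrightarrow> hs ! i = hs ! j \<Longrightarrow> f hs = 0"
    by (simp_all add: hom_cochains_def alternating_multilinear_def) blast
  have lin': "Vector_Spaces.linear s1 s2 (\<lambda>v. f (as @ v # bs))"
    if "length as + length bs = n" for as bs
    using lin[of "as @ undefined # bs" "length as"] that by (simp add: list_update_append)
  have ?add
  proof (intro allI)
    fix as x y bs
    show "f (as @ (x + y) # bs) = f (as @ x # bs) + f (as @ y # bs)"
      by (cases "length as + length bs = n") (use lin'[of as bs] in \<open>auto simp: Vector_Spaces.linear_iff len\<close>)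
  qed
  moreover have ?scale
  proof (intro allI)
    fix as c x bs
    show "f (as @ s1 c x # bs) = s2 c (f (as @ x # bs))"
      by (cases "length as + length bs = n") (use lin'[of as bs] in \<open>auto simp: Vector_Spaces.linear_iff len\<close>)
  qed
  moreover have ?alt
  proof (intro allI)
    fix as x bs
    show "f (as @ x # x # bs) = 0"
      by (cases "Suc (length as + length bs) = n")
        (use alt[of "as @ x # x # bs" "length as" "Suc (length as)"] in
          \<open>auto simp: len nth_append\<close>)
  qed
  ultimately show "?len \<and> ?add \<and> ?scale \<and> ?alt \<and> ?hom" using len hom by blast
next
  assume R: "?len \<and> ?add \<and> ?scale \<and> ?alt \<and> ?hom"
  have "Vector_Spaces.linear s1 s2 (\<lambda>v. f (hs[i := v]))"
    if "length hs = Suc n" "i < Suc n" for hs i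
    using that R assms by (simp add: Vector_Spaces.linear_iff upd_conv_take_nth_drop)
  moreover have "f hs = 0"
    if "length hs = Suc n" "i < j" "j < Suc n" "hs ! i = hs ! j" for hs i j
  proof -
    have "hs = take i hs @ drop i hs" by simp
    also have "drop i hs = hs ! i # drop (Suc i) hs"
      using that Cons_nth_drop_Suc[of i hs] by simp
    also have "drop (Suc i) hs = take (j - Suc i) (drop (Suc i) hs) @ drop j hs"
      using that by (metis Suc_leI append_take_drop_id drop_drop le_add_diff_inverse2)
    also have "drop j hs = hs ! i # drop (Suc j) hs"
      using that Cons_nth_drop_Suc[of j hs] by simp
    finally have "hs = take i hs @ hs ! i # take (j - Suc i) (drop (Suc i) hs)
      @ hs ! i # drop (Suc j) hs" .
    moreover have "f (take i hs @ hs ! i # take (j - Suc i) (drop (Suc i) hs)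
      @ hs ! i # drop (Suc j) hs) = 0"
      by (rule alternating_of_adjacent) (use R in auto)
    ultimately show ?thesis by simp
  qed
  ultimately show ?L
    using R by (simp add: hom_cochains_def alternating_multilinear_def) blast
qed

section \<open>Composition of Hom-cochains\<close>

text \<open>
  The insertion of \<open>g\<close> into \<open>f\<close>. The exponent of the twist is read off the length of the list that
  \<open>g\<close> takes, so no degrees occur; at \<open>length a = 0\<close>, where the difference is truncated, a cochain \<open>g\<close> vanishes.
\<close>

definition circ ::
  "('v \<Rightarrow> 'v) \<Rightarrow> ('v list \<Rightarrow> 'w::ab_group_add) \<Rightarrow> ('v list \<Rightarrow> 'v) \<Rightarrow> 'v list \<Rightarrow> 'w" where
  "circ \<gamma> f g xs = unshuffle_sum xs (\<lambda>a b. f (g a # map (\<gamma> ^^ (length a - 1)) b))"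

locale twisted_space = vector_space scale
  for scale :: "'k::field_char_0 \<Rightarrow> 'v::ab_group_add \<Rightarrow> 'v" +
  fixes \<gamma> :: "'v \<Rightarrow> 'v"
  assumes linear_twist: "Vector_Spaces.linear scale scale \<gamma>"
begin

text \<open>
  The index is the arity minus one, which is the degree that makes the Nijenhuis-Richardson bracket
  homogeneous of degree zero.
\<close>

abbreviation cochains :: "nat \<Rightarrow> ('v list \<Rightarrow> 'v) set" where
  "cochains p \<equiv> hom_cochains scale \<gamma> scale \<gamma> (Suc p)"

lemmas cochains_iff = hom_cochains_Suc_iff[OF vector_space_axioms vector_space_axioms]

lemma cochain_length: "f \<in> cochains p \<Longrightarrow> length hs \<noteq> Suc p \<Longrightarrow> f hs = 0"
  and cochain_add: "f \<in> cochains p \<Longrightarrow> f (as @ (x + y) # bs) = f (as @ x # bs) + f (as @ y # bs)"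
  and cochain_scale: "f \<in> cochains p \<Longrightarrow> f (as @ scale c x # bs) = scale c (f (as @ x # bs))"
  and cochain_alt: "f \<in> cochains p \<Longrightarrow> f (as @ x # x # bs) = 0"
  and cochain_twist: "f \<in> cochains p \<Longrightarrow> \<gamma> (f hs) = f (map \<gamma> hs)"
  by (simp_all add: cochains_iff)

lemma cochain_add_head: "f \<in> cochains p \<Longrightarrow> f ((x + y) # bs) = f (x # bs) + f (y # bs)"
  and cochain_scale_head: "f \<in> cochains p \<Longrightarrow> f (scale c x # bs) = scale c (f (x # bs))"
  using cochain_add[of f p "[]"] cochain_scale[of f p "[]"] by simp_all

lemma cochain_zero: "f \<in> cochains p \<Longrightarrow> f (as @ 0 # bs) = 0"
  using cochain_add[of f p as 0 0 bs] by simp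

lemma cochain_zero_head: "f \<in> cochains p \<Longrightarrow> f (0 # bs) = 0"
  using cochain_zero[of f p "[]"] by simp

lemma cochain_swap: "f \<in> cochains p \<Longrightarrow> f (x # y # bs) = - f (y # x # bs)"
  using adjacent_swap[of f "[]" x y bs] cochain_add cochain_alt by simp

lemma twist_add: "\<gamma> (x + y) = \<gamma> x + \<gamma> y" and twist_scale: "\<gamma> (scale c x) = scale c (\<gamma> x)"
  using linear_twist unfolding Vector_Spaces.linear_iff by blast+

lemma twist_power_add: "(\<gamma> ^^ k) (x + y) = (\<gamma> ^^ k) x + (\<gamma> ^^ k) y"
  and twist_power_scale: "(\<gamma> ^^ k) (scale c x) = scale c ((\<gamma> ^^ k) x)"
  by (induction k) (simp_all add: twist_add twist_scale)

lemma cochain_twist_power: "f \<in> cochains p \<Longrightarrow> (\<gamma> ^^ k) (f hs) = f (map (\<gamma> ^^ k) hs)"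
  by (induction k arbitrary: hs) (simp_all add: cochain_twist)

lemma cochains_zero: "0 \<in> cochains p"
  using twist_add[of 0 0] by (simp add: cochains_iff)

lemma cochains_add: "f \<in> cochains p \<Longrightarrow> g \<in> cochains p \<Longrightarrow> f + g \<in> cochains p"
  by (simp add: cochains_iff scale_right_distrib twist_add)

lemma cochains_scale: "f \<in> cochains p \<Longrightarrow> cochain_scale scale c f \<in> cochains p"
  by (simp add: cochains_iff cochain_scale_def scale_right_distrib twist_scale mult.commute)

lemma cochains_minus: "f \<in> cochains p \<Longrightarrow> - f \<in> cochains p"
  using cochains_scale[of f p "-1"] by (simp add: cochain_scale_def fun_Compl_def)

lemma cochains_signed: "f \<in> cochains p \<Longrightarrow> signed k f \<in> cochains p"
  by (simp add: signed_def cochains_minus)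

lemma circ_cochains:
  assumes f: "f \<in> cochains p" and g: "g \<in> cochains q"
  shows "circ \<gamma> f g \<in> cochains (p + q)"
proof -
  let ?F = "\<lambda>a b. f (g a # map (\<gamma> ^^ (length a - 1)) b)"
  have tail: "P (g c # map h (a @ x # b)) = P ((g c # map h a) @ h x # map h b)" for P c h a x b
    by simp
  have "circ \<gamma> f g hs = 0" if "length hs \<noteq> Suc (p + q)" for hs
  proof -
    have "unshuffle_sum hs ?F = unshuffle_sum hs (\<lambda>a b. 0)"
    proof (rule unshuffle_sum_cong)
      fix a b :: "'v list"
      assume "length a + length b = length hs"
      then have "length a \<noteq> Suc q \<or> length (g a # map (\<gamma> ^^ (length a - 1)) b) \<noteq> Suc p"
        using that by auto
      then show "?F a b = 0"
        using cochain_length[OF f] cochain_length[OF g] cochain_zero_head[OF f] by metis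
    qed
    then show ?thesis by (simp add: circ_def)
  qed
  moreover have "circ \<gamma> f g (as @ (x + y) # bs) = circ \<gamma> f g (as @ x # bs) + circ \<gamma> f g (as @ y # bs)"
    for as x y bs
    unfolding circ_def
  proof (rule unshuffle_sum_slot_add)
    show "?F (a @ (x + y) # b) c = ?F (a @ x # b) c + ?F (a @ y # b) c" for a b c
      by (simp add: cochain_add[OF g] cochain_add_head[OF f])
    show "?F c (a @ (x + y) # b) = ?F c (a @ x # b) + ?F c (a @ y # b)" for a b c
      unfolding tail twist_power_add by (rule cochain_add[OF f])
  qed
  moreover have "circ \<gamma> f g (as @ scale c x # bs) = scale c (circ \<gamma> f g (as @ x # bs))"
    for as c x bs
    unfolding circ_def
  proof (rule unshuffle_sum_slot_additive[where T = "scale c"])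
    show "?F (a @ scale c x # b) d = scale c (?F (a @ x # b) d)" for a b d
      by (simp add: cochain_scale[OF g] cochain_scale_head[OF f])
    show "?F d (a @ scale c x # b) = scale c (?F d (a @ x # b))" for a b d
      unfolding tail twist_power_scale by (rule cochain_scale[OF f])
  qed (simp add: scale_right_distrib)
  moreover have "circ \<gamma> f g (as @ x # x # bs) = 0" for as x bs
    unfolding circ_def
  proof (rule unshuffle_sum_alternating)
    show "?F (a @ x # x # b) c = 0" for a b c
      by (simp add: cochain_alt[OF g] cochain_zero_head[OF f])
    show "?F c (a @ x # x # b) = 0" for a b c
      unfolding tail list.map by (rule cochain_alt[OF f])
  qed
  moreover have "\<gamma> (circ \<gamma> f g hs) = circ \<gamma> f g (map \<gamma> hs)" for hs
    by (simp add: circ_def unshuffle_sum_additive[of \<gamma>, OF twist_add] unshuffle_sum_map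
        cochain_twist[OF f] cochain_twist[OF g] o_def funpow_swap1)
  ultimately show ?thesis by (simp add: cochains_iff)
qed

lemma circ_add_left: "circ \<gamma> (f + f') g = circ \<gamma> f g + circ \<gamma> f' g"
  by (auto simp: circ_def fun_eq_iff unshuffle_sum_add)

lemma circ_add_right:
  "f \<in> cochains p \<Longrightarrow> circ \<gamma> f (g + g') = circ \<gamma> f g + circ \<gamma> f g'"
  by (auto simp: circ_def fun_eq_iff unshuffle_sum_add cochain_add_head)

lemma circ_scale_left: "circ \<gamma> (cochain_scale scale c f) g = cochain_scale scale c (circ \<gamma> f g)"
  by (auto simp: circ_def fun_eq_iff cochain_scale_def scale_right_distrib
      unshuffle_sum_additive[of "scale c"])

lemma circ_scale_right:
  "f \<in> cochains p \<Longrightarrow> circ \<gamma> f (cochain_scale scale c g) = cochain_scale scale c (circ \<gamma> f g)"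
  by (auto simp: circ_def fun_eq_iff cochain_scale_def scale_right_distrib cochain_scale_head
      unshuffle_sum_additive[of "scale c"])

text \<open>
  The part of \<open>(f \<circ> g) \<circ> h\<close> in which \<open>g\<close> and \<open>h\<close> occupy different slots of \<open>f\<close>. The value of \<open>h\<close> enters
  as the first argument of \<open>f \<circ> g\<close>, and the arguments \<open>c\<close> of \<open>g\<close> pass it, whence the sign.
\<close>

definition circ_assoc where
  "circ_assoc f g h xs = unshuffle_sum xs (\<lambda>u d. unshuffle_sum u (\<lambda>a c. signed (length c)
     (f (g (map (\<gamma> ^^ (length a - 1)) c) # (\<gamma> ^^ (length c - 1)) (h a) #
        map (\<gamma> ^^ (length a + length c - 2)) d))))"

text \<open>
  The argument list of \<open>f \<circ> g\<close> starts with the value of \<open>h\<close>. Splitting off this first entry, either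
  \<open>g\<close> takes it, which by coassociativity is \<open>f \<circ> (g \<circ> h)\<close>, or \<open>f\<close> takes it directly.
\<close>

lemma circ_circ:
  assumes f: "f \<in> cochains p" and g: "g \<in> cochains q" and h: "h \<in> cochains r"
  shows "circ \<gamma> (circ \<gamma> f g) h = circ \<gamma> f (circ \<gamma> g h) + circ_assoc f g h"
proof
  fix xs
  have *: "circ \<gamma> f (circ \<gamma> g h) xs = unshuffle_sum xs (\<lambda>u d. unshuffle_sum u (\<lambda>a c.
     f (g (h a # map (\<gamma> ^^ (length a - 1)) c) # map (\<gamma> ^^ (length a + length c - 1)) d)))"
    unfolding circ_def
  proof (rule unshuffle_sum_cong)
    fix u d :: "'v list"
    have "f (unshuffle_sum u (\<lambda>a b. g (h a # map (\<gamma> ^^ (length a - 1)) b)) # map (\<gamma> ^^ (length u - 1)) d)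
      = unshuffle_sum u (\<lambda>a c. f (g (h a # map (\<gamma> ^^ (length a - 1)) c) # map (\<gamma> ^^ (length u - 1)) d))"
      by (rule unshuffle_sum_additive[of "\<lambda>v. f (v # map (\<gamma> ^^ (length u - 1)) d)"])
        (rule cochain_add_head[OF f])
    also have "\<dots> = unshuffle_sum u (\<lambda>a c. f (g (h a # map (\<gamma> ^^ (length a - 1)) c)
        # map (\<gamma> ^^ (length a + length c - 1)) d))"
      by (rule unshuffle_sum_cong) simp
    finally show "f (unshuffle_sum u (\<lambda>a b. g (h a # map (\<gamma> ^^ (length a - 1)) b)) #
        map (\<gamma> ^^ (length u - 1)) d) = \<dots>" .
  qed
  have "circ \<gamma> (circ \<gamma> f g) h xs = unshuffle_sum xs (\<lambda>a b. unshuffle_sum b (\<lambda>c d.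
       f (g (h a # map (\<gamma> ^^ (length a - 1)) c) # map (\<gamma> ^^ (length a + length c - 1)) d)
       + signed (length c)
     (f (g (map (\<gamma> ^^ (length a - 1)) c) # (\<gamma> ^^ (length c - 1)) (h a) #
        map (\<gamma> ^^ (length a + length c - 2)) d))))"
    unfolding circ_def
  proof (rule unshuffle_sum_cong)
    fix a b :: "'v list"
    have "f (g (h a # map (\<gamma> ^^ (length a - 1)) c) # map (\<gamma> ^^ length c \<circ> \<gamma> ^^ (length a - 1)) d)
      = f (g (h a # map (\<gamma> ^^ (length a - 1)) c) # map (\<gamma> ^^ (length a + length c - 1)) d)" for c d
      by (cases a) (simp_all add: cochain_length[OF h] cochain_zero_head[OF f] cochain_zero_head[OF g]
          add.commute flip: funpow_add)
    moreover have "f (g (map (\<gamma> ^^ (length a - 1)) c) # (\<gamma> ^^ (length c - 1)) (h a) #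
         map (\<gamma> ^^ (length c - 1) \<circ> \<gamma> ^^ (length a - 1)) d)
      = f (g (map (\<gamma> ^^ (length a - 1)) c) # (\<gamma> ^^ (length c - 1)) (h a) #
        map (\<gamma> ^^ (length a + length c - 2)) d)" for c d
    \<comment> \<open>The truncated differences only add up when both lists are nonempty; otherwise a value of \<open>g\<close> or \<open>h\<close> vanishes.\<close>
    proof (cases "a = [] \<or> c = []")
      case True
      then show ?thesis
        using cochain_zero[OF f, of "[g (map (\<gamma> ^^ (length a - 1)) c)]"]
        by (auto simp: cochain_length[OF h] cochain_length[OF g] cochain_zero_head[OF f]
            cochain_twist_power[OF h])
    next
      case False
      then have "length c - 1 + (length a - 1) = length a + length c - 2"
        by (cases a; cases c) auto
      then show ?thesis by (simp flip: funpow_add)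
    qed
    ultimately show "unshuffle_sum (h a # map (\<gamma> ^^ (length a - 1)) b)
        (\<lambda>a b. f (g a # map (\<gamma> ^^ (length a - 1)) b))
      = unshuffle_sum b (\<lambda>c d.
       f (g (h a # map (\<gamma> ^^ (length a - 1)) c) # map (\<gamma> ^^ (length a + length c - 1)) d)
       + signed (length c)
     (f (g (map (\<gamma> ^^ (length a - 1)) c) # (\<gamma> ^^ (length c - 1)) (h a) #
        map (\<gamma> ^^ (length a + length c - 2)) d)))"
      by (simp add: unshuffle_sum_map unshuffle_sum_add)
  qed
  also have "\<dots> = circ \<gamma> f (circ \<gamma> g h) xs + circ_assoc f g h xs"
    unfolding * circ_assoc_def
    by (simp add: unshuffle_sum_assoc unshuffle_sum_add)
  finally show "circ \<gamma> (circ \<gamma> f g) h xs = (circ \<gamma> f (circ \<gamma> g h) + circ_assoc f g h) xs"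
    by simp
qed

text \<open>
  The graded right pre-Lie identity. Interchanging the blocks of arguments of \<open>g\<close> and \<open>h\<close> and the two
  values inside \<open>f\<close>, the signs combine to \<open>(-1)\<^bsup>qr\<^esup>\<close>. The summands match because \<open>g\<close> and \<open>h\<close> commute with
  \<open>\<gamma>\<close>: the twist on the value of one is a twist of its arguments.
\<close>

lemma circ_assoc_symmetric:
  assumes f: "f \<in> cochains p" and g: "g \<in> cochains q" and h: "h \<in> cochains r"
  shows "circ_assoc f h g = signed (q * r) (circ_assoc f g h)"
proof
  fix xs
  have "circ_assoc f h g xs = unshuffle_sum xs (\<lambda>u d. unshuffle_sum u (\<lambda>a c.
     signed (length a * length c) (signed (length a)
     (f (h (map (\<gamma> ^^ (length c - 1)) a) # (\<gamma> ^^ (length a - 1)) (g c) #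
        map (\<gamma> ^^ (length c + length a - 2)) d)))))"
    unfolding circ_assoc_def
    by (rule unshuffle_sum_cong) (rule unshuffle_sum_commute)
  also have "\<dots> = unshuffle_sum xs (\<lambda>u d. unshuffle_sum u (\<lambda>a c.
      signed (q * r) (signed (length c)
     (f (g (map (\<gamma> ^^ (length a - 1)) c) # (\<gamma> ^^ (length c - 1)) (h a) #
        map (\<gamma> ^^ (length a + length c - 2)) d)))))"
  proof (intro unshuffle_sum_cong)
    fix a c d :: "'v list"
    show "signed (length a * length c) (signed (length a)
     (f (h (map (\<gamma> ^^ (length c - 1)) a) # (\<gamma> ^^ (length a - 1)) (g c) #
        map (\<gamma> ^^ (length c + length a - 2)) d))) = signed (q * r) (signed (length c)
     (f (g (map (\<gamma> ^^ (length a - 1)) c) # (\<gamma> ^^ (length c - 1)) (h a) #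
        map (\<gamma> ^^ (length a + length c - 2)) d)))"
      (is "signed _ (signed _ ?l) = signed _ (signed _ ?r)")
    proof (cases "length a = Suc r \<and> length c = Suc q")
      case True
      have "?l = - ?r"
        unfolding cochain_twist_power[OF g] cochain_twist_power[OF h] add.commute[of "length c"]
        by (rule cochain_swap[OF f])
      with True show ?thesis by (auto simp: signed_def)
    next
      case False
      then have "?l = 0" "?r = 0"
        using cochain_zero[OF f, of "[_]"]
        by (auto simp: cochain_twist_power[OF g] cochain_twist_power[OF h]
            cochain_length[OF g] cochain_length[OF h] cochain_zero_head[OF f])
      then show ?thesis by simp
    qed
  qed
  also have "\<dots> = signed (q * r) (circ_assoc f g h xs)"
    by (simp only: unshuffle_sum_signed circ_assoc_def)
  finally show "circ_assoc f h g xs = signed (q * r) (circ_assoc f g h) xs"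
    by (simp add: signed_def)
qed

end

section \<open>Derived brackets in graded Lie rings\<close>

text \<open>
  The bracket takes the degrees of its arguments as parameters, since the sign of the graded
  commutator depends on them and an element does not determine its degree (zero has every degree).
  The absence of two-torsion stands for characteristic zero: it makes an odd element whose bracket
  with itself is zero act with square zero.
\<close>

locale graded_lie_ring =
  fixes C :: "nat \<Rightarrow> 'a::ab_group_add set" and br :: "nat \<Rightarrow> nat \<Rightarrow> 'a \<Rightarrow> 'a \<Rightarrow> 'a"
  assumes zero_closed: "0 \<in> C p"
    and signed_closed: "x \<in> C p \<Longrightarrow> signed k x \<in> C p"
    and br_closed: "x \<in> C p \<Longrightarrow> y \<in> C q \<Longrightarrow> br p q x y \<in> C (p + q)"
    and br_add_left: "x \<in> C p \<Longrightarrow> x' \<in> C p \<Longrightarrow> y \<in> C q \<Longrightarrow> br p q (x + x') y = br p q x y + br p q x' y"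
    and br_add_right: "x \<in> C p \<Longrightarrow> y \<in> C q \<Longrightarrow> y' \<in> C q \<Longrightarrow> br p q x (y + y') = br p q x y + br p q x y'"
    and br_skew: "x \<in> C p \<Longrightarrow> y \<in> C q \<Longrightarrow> br p q x y = - signed (p * q) (br q p y x)"
    and br_jacobi: "x \<in> C p \<Longrightarrow> y \<in> C q \<Longrightarrow> z \<in> C r \<Longrightarrow>
      br p (q + r) x (br q r y z) =
        br (p + q) r (br p q x y) z + signed (p * q) (br q (p + r) y (br p r x z))"
    and no_two_torsion: "x \<in> C p \<Longrightarrow> x + x = 0 \<Longrightarrow> x = 0"
begin

lemma br_zero_left: "y \<in> C q \<Longrightarrow> br p q 0 y = 0"
  using br_add_left[of 0 p 0 y q] by (simp add: zero_closed)

lemma br_zero_right: "x \<in> C p \<Longrightarrow> br p q x 0 = 0"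
  using br_add_right[of x p 0 q 0] by (simp add: zero_closed)

lemma minus_closed: "x \<in> C p \<Longrightarrow> - x \<in> C p"
  using signed_closed[of x p 1] by simp

lemma br_signed_left: "x \<in> C p \<Longrightarrow> y \<in> C q \<Longrightarrow> br p q (signed k x) y = signed k (br p q x y)"
  using br_add_left[of x p "- x" y q] minus_closed[of x p]
  by (simp add: br_zero_left signed_def add_eq_0_iff)

lemma br_signed_right: "x \<in> C p \<Longrightarrow> y \<in> C q \<Longrightarrow> br p q x (signed k y) = signed k (br p q x y)"
  using br_add_right[of x p y q "- y"] minus_closed[of y q]
  by (simp add: br_zero_right signed_def add_eq_0_iff)

text \<open>
  The sign is the usual \<open>(-1)\<^bsup>p+1\<^esup>\<close> of a derived bracket times \<open>(-1)\<^bsup>(p+1)(q+1)\<^esup>\<close>. The second factor is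
  a symmetric bicharacter of the shifted degrees \<open>p + 1\<close>, \<open>q + 1\<close>, so multiplying by it preserves the
  axioms of a graded Lie bracket.
\<close>

definition derived :: "'a \<Rightarrow> nat \<Rightarrow> nat \<Rightarrow> 'a \<Rightarrow> 'a \<Rightarrow> 'a" where
  "derived \<pi> p q x y = signed (Suc p * q) (br (Suc p) q (br (Suc 0) p \<pi> x) y)"

lemma ad_closed: "\<pi> \<in> C (Suc 0) \<Longrightarrow> x \<in> C p \<Longrightarrow> br (Suc 0) p \<pi> x \<in> C (Suc p)"
  using br_closed[of \<pi> "Suc 0" x p] by simp

lemma derived_closed:
  "\<pi> \<in> C (Suc 0) \<Longrightarrow> x \<in> C p \<Longrightarrow> y \<in> C q \<Longrightarrow> derived \<pi> p q x y \<in> C (Suc (p + q))"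
  unfolding derived_def using br_closed[of "br (Suc 0) p \<pi> x" "Suc p" y q] ad_closed[of \<pi> x p]
  by (simp add: signed_closed)

text \<open>
  By the Jacobi identity the odd derivation \<open>[\<pi>, \<cdot>]\<close> satisfies \<open>[\<pi>, [\<pi>, x]] = -[\<pi>, [\<pi>, x]]\<close>.
\<close>

lemma square_zero:
  assumes pi: "\<pi> \<in> C (Suc 0)" and "br (Suc 0) (Suc 0) \<pi> \<pi> = 0" and x: "x \<in> C p"
  shows "br (Suc 0) (Suc p) \<pi> (br (Suc 0) p \<pi> x) = 0"
proof -
  let ?D = "br (Suc 0) (Suc p) \<pi> (br (Suc 0) p \<pi> x)"
  have "?D = - ?D"
    using br_jacobi[OF pi pi x] assms(2) br_zero_left[OF x] by simp
  then have "?D + ?D = 0" by (simp add: eq_neg_iff_add_eq_0)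
  then show ?thesis
    using no_two_torsion[of ?D "Suc (Suc p)"] ad_closed[OF pi ad_closed[OF pi x]] by blast
qed

text \<open>
  Apply the derivation \<open>[\<pi>, \<cdot>]\<close> to \<open>[x, y] = 0\<close>: the two terms are the two derived brackets.
\<close>

lemma derived_skew:
  assumes pi: "\<pi> \<in> C (Suc 0)" and x: "x \<in> C p" and y: "y \<in> C q" and xy: "br p q x y = 0"
  shows "derived \<pi> p q x y = - signed (Suc p * Suc q) (derived \<pi> q p y x)"
proof -
  have "br (Suc 0) (p + q) \<pi> (br p q x y) = 0"
    using xy br_zero_right[OF pi] by simp
  then have "br (Suc p) q (br (Suc 0) p \<pi> x) y = - signed p (br p (Suc q) x (br (Suc 0) q \<pi> y))"
    using br_jacobi[OF pi x y] by (simp add: eq_neg_iff_add_eq_0)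
  moreover have "br p (Suc q) x (br (Suc 0) q \<pi> y)
    = - signed (p * Suc q) (br (Suc q) p (br (Suc 0) q \<pi> y) x)"
    by (rule br_skew[OF x ad_closed[OF pi y]])
  ultimately show ?thesis
    unfolding derived_def by (auto simp: signed_def)
qed

text \<open>
  The map \<open>[\<pi>, \<cdot>]\<close> turns the derived bracket into the original one, up to sign.
\<close>

lemma ad_derived:
  assumes pi: "\<pi> \<in> C (Suc 0)" and "br (Suc 0) (Suc 0) \<pi> \<pi> = 0" and x: "x \<in> C p" and y: "y \<in> C q"
  shows "br (Suc p) (Suc q) (br (Suc 0) p \<pi> x) (br (Suc 0) q \<pi> y)
    = signed (Suc p) (br (Suc 0) (Suc (p + q)) \<pi> (br (Suc p) q (br (Suc 0) p \<pi> x) y))"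
  using br_jacobi[OF pi ad_closed[OF pi x] y] square_zero[OF assms(1-3)] br_zero_left[OF y]
  by (simp add: signed_def)

text \<open>
  The Jacobi identity of \<open>[\<pi>, x]\<close>, \<open>[\<pi>, y]\<close> and \<open>z\<close>, in which \<open>ad_derived\<close> rewrites \<open>[[\<pi>, x], [\<pi>, y]]\<close>.
\<close>

lemma derived_jacobi:
  assumes pi: "\<pi> \<in> C (Suc 0)" and pp: "br (Suc 0) (Suc 0) \<pi> \<pi> = 0"
    and x: "x \<in> C p" and y: "y \<in> C q" and z: "z \<in> C r"
  shows "derived \<pi> p (Suc (q + r)) x (derived \<pi> q r y z) =
      derived \<pi> (Suc (p + q)) r (derived \<pi> p q x y) z
      + signed (Suc p * Suc q) (derived \<pi> q (Suc (p + r)) y (derived \<pi> p r x z))"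
proof -
  let ?u = "br (Suc 0) p \<pi> x" and ?v = "br (Suc 0) q \<pi> y"
  have u: "?u \<in> C (Suc p)" and v: "?v \<in> C (Suc q)"
    using ad_closed pi x y by auto
  have uy: "br (Suc p) q ?u y \<in> C (Suc (p + q))" and vz: "br (Suc q) r ?v z \<in> C (Suc (q + r))"
    and uz: "br (Suc p) r ?u z \<in> C (Suc (p + r))"
    using br_closed[OF u y] br_closed[OF v z] br_closed[OF u z] by auto
  have piuy: "br (Suc 0) (Suc (p + q)) \<pi> (br (Suc p) q ?u y) \<in> C (Suc (Suc (p + q)))"
    by (rule ad_closed[OF pi uy])
  have "br (Suc p) (Suc (q + r)) ?u (br (Suc q) r ?v z)
    = signed (Suc p) (br (Suc (Suc (p + q))) r (br (Suc 0) (Suc (p + q)) \<pi> (br (Suc p) q ?u y)) z)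
      + signed (Suc p * Suc q) (br (Suc q) (Suc (p + r)) ?v (br (Suc p) r ?u z))"
    using br_jacobi[OF u v z] br_signed_left[OF piuy z, of "Suc p"]
    unfolding ad_derived[OF pi pp x y] by (simp del: signed_Suc)
  then show ?thesis
    unfolding derived_def br_signed_right[OF u vz] br_signed_right[OF v uz]
      br_signed_right[OF pi uy] br_signed_left[OF piuy z]
    by (auto simp: signed_def)
qed

text \<open>
  The sign makes this a derivation of \<open>derived\<close>: the latter carries the factor
  \<open>(-1)\<^bsup>(p+1)(q+1)\<^esup>\<close>, which changes when the degree of one argument is raised.
\<close>

definition codifferential :: "'a \<Rightarrow> nat \<Rightarrow> 'a \<Rightarrow> 'a" where
  "codifferential \<mu> p x = signed p (br (Suc 0) p \<mu> x)"

lemma codifferential_square: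
  assumes "\<mu> \<in> C (Suc 0)" "br (Suc 0) (Suc 0) \<mu> \<mu> = 0" "x \<in> C p"
  shows "codifferential \<mu> (Suc p) (codifferential \<mu> p x) = 0"
  using square_zero[OF assms] br_signed_right[OF assms(1) ad_closed[OF assms(1,3)]]
  by (simp add: codifferential_def)

text \<open>
  As \<open>[\<mu>, \<pi>] = 0\<close>, the odd derivations \<open>[\<mu>, \<cdot>]\<close> and \<open>[\<pi>, \<cdot>]\<close> anticommute; the claim is the Leibniz rule
  for \<open>[\<mu>, [[\<pi>, x], y]]\<close>.
\<close>

lemma codifferential_derived:
  assumes pi: "\<pi> \<in> C (Suc 0)" and mu: "\<mu> \<in> C (Suc 0)" and mp: "br (Suc 0) (Suc 0) \<mu> \<pi> = 0"
    and x: "x \<in> C p" and y: "y \<in> C q"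
  shows "codifferential \<mu> (Suc (p + q)) (derived \<pi> p q x y) =
      derived \<pi> (Suc p) q (codifferential \<mu> p x) y
      + signed (Suc p) (derived \<pi> p (Suc q) x (codifferential \<mu> q y))"
proof -
  let ?u = "br (Suc 0) p \<pi> x" and ?x = "br (Suc 0) p \<mu> x" and ?y = "br (Suc 0) q \<mu> y"
  have u: "?u \<in> C (Suc p)" and x': "?x \<in> C (Suc p)" and y': "?y \<in> C (Suc q)"
    using ad_closed pi mu x y by auto
  have pix: "br (Suc 0) (Suc p) \<pi> ?x \<in> C (Suc (Suc p))" by (rule ad_closed[OF pi x'])
  have uy: "br (Suc p) q ?u y \<in> C (Suc (p + q))" using br_closed[OF u y] by simp
  have "br (Suc 0) (Suc p) \<mu> ?u = signed 1 (br (Suc 0) (Suc p) \<pi> ?x)"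
    using br_jacobi[OF mu pi x] mp br_zero_left[OF x] by simp
  then have "br (Suc 0) (Suc (p + q)) \<mu> (br (Suc p) q ?u y) =
     signed 1 (br (Suc (Suc p)) q (br (Suc 0) (Suc p) \<pi> ?x) y)
     + signed (Suc p) (br (Suc p) (Suc q) ?u ?y)"
    using br_jacobi[OF mu u y] br_signed_left[OF pix y, of 1] by simp
  then show ?thesis
    unfolding derived_def codifferential_def br_signed_right[OF mu uy] br_signed_right[OF u y']
      br_signed_right[OF pi x'] br_signed_left[OF pix y]
    by (auto simp: signed_def)
qed

end

context twisted_space
begin

section \<open>The Nijenhuis-Richardson bracket\<close>

definition nr_bracket :: "nat \<Rightarrow> nat \<Rightarrow> ('v list \<Rightarrow> 'v) \<Rightarrow> ('v list \<Rightarrow> 'v) \<Rightarrow> 'v list \<Rightarrow> 'v" where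
  "nr_bracket p q f g = circ \<gamma> f g - signed (p * q) (circ \<gamma> g f)"

lemma circ_signed_left:
  fixes f :: "'v list \<Rightarrow> 'v"
  shows "circ \<gamma> (signed k f) g = signed k (circ \<gamma> f g)"
  using circ_scale_left[of "-1" f g]
  by (simp add: signed_def cochain_scale_def fun_Compl_def)

lemma circ_signed_right:
  "f \<in> cochains p \<Longrightarrow> circ \<gamma> f (signed k g) = signed k (circ \<gamma> f g)"
  using circ_scale_right[of f p "-1" g]
  by (simp add: signed_def cochain_scale_def fun_Compl_def)

lemma circ_diff_left: "circ \<gamma> (f - f') g = circ \<gamma> f g - circ \<gamma> f' g"
  using circ_add_left[of "f - f'" f' g] by simp

lemma circ_diff_right:
  "f \<in> cochains p \<Longrightarrow> circ \<gamma> f (g - g') = circ \<gamma> f g - circ \<gamma> f g'"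
  using circ_add_right[of f p "g - g'" g'] by simp

text \<open>
  Every composite \<open>(f \<circ> g) \<circ> h\<close> is replaced by \<open>f \<circ> (g \<circ> h)\<close> plus an associator. The nested
  composites cancel identically, the associators by the pre-Lie identity.
\<close>

lemma nr_jacobi:
  assumes f: "f \<in> cochains p" and g: "g \<in> cochains q" and h: "h \<in> cochains r"
  shows "nr_bracket p (q + r) f (nr_bracket q r g h) =
      nr_bracket (p + q) r (nr_bracket p q f g) h
      + signed (p * q) (nr_bracket q (p + r) g (nr_bracket p r f h))"
  unfolding nr_bracket_def circ_diff_left circ_diff_right[OF f] circ_diff_right[OF g]
    circ_diff_right[OF h] circ_signed_left circ_signed_right[OF f] circ_signed_right[OF g]
    circ_signed_right[OF h] circ_circ[OF f g h] circ_circ[OF f h g] circ_circ[OF g f h]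
    circ_circ[OF g h f] circ_circ[OF h f g] circ_circ[OF h g f]
    circ_assoc_symmetric[OF f g h] circ_assoc_symmetric[OF g f h] circ_assoc_symmetric[OF h f g]
  by (cases "even p"; cases "even q"; cases "even r") (simp_all add: signed_def algebra_simps)

sublocale nr: graded_lie_ring cochains nr_bracket
proof
  fix f f' g g' h :: "'v list \<Rightarrow> 'v" and p q r k :: nat
  show "0 \<in> cochains p" by (rule cochains_zero)
  show "signed k f \<in> cochains p" if "f \<in> cochains p" using that by (rule cochains_signed)
  show "nr_bracket p q f g \<in> cochains (p + q)" if "f \<in> cochains p" "g \<in> cochains q"
    using circ_cochains[OF that] circ_cochains[OF that(2,1)]
      cochains_add[of "circ \<gamma> f g" "p + q" "- signed (p * q) (circ \<gamma> g f)"]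
    by (simp add: nr_bracket_def cochains_minus cochains_signed add.commute)
  show "nr_bracket p q (f + f') g = nr_bracket p q f g + nr_bracket p q f' g"
    if "f \<in> cochains p" "f' \<in> cochains p" "g \<in> cochains q"
    using that by (simp add: nr_bracket_def circ_add_left circ_add_right signed_add)
  show "nr_bracket p q f (g + g') = nr_bracket p q f g + nr_bracket p q f g'"
    if "f \<in> cochains p" "g \<in> cochains q" "g' \<in> cochains q"
    using that by (simp add: nr_bracket_def circ_add_left circ_add_right signed_add)
  show "nr_bracket p q f g = - signed (p * q) (nr_bracket q p g f)"
    by (auto simp: nr_bracket_def signed_def)
  show "nr_bracket p (q + r) f (nr_bracket q r g h) =
      nr_bracket (p + q) r (nr_bracket p q f g) h
      + signed (p * q) (nr_bracket q (p + r) g (nr_bracket p r f h))"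
    if "f \<in> cochains p" "g \<in> cochains q" "h \<in> cochains r"
    using that by (rule nr_jacobi)
  show "f = 0" if "f \<in> cochains p" "f + f = 0"
  proof
    fix hs
    have "scale 2 (f hs) = f hs + f hs"
      using scale_left_distrib[of 1 1 "f hs"] by simp
    also have "\<dots> = 0" using that(2) by (simp add: fun_eq_iff)
    finally show "f hs = 0 hs" by simp
  qed
qed

end

section \<open>Binary cochains and the semidirect product\<close>

definition binary :: "('v \<Rightarrow> 'v \<Rightarrow> 'v::zero) \<Rightarrow> 'v list \<Rightarrow> 'v" where
  "binary B vs = (case vs of [v, w] \<Rightarrow> B v w | _ \<Rightarrow> 0)"

lemma binary_simps [simp]:
  "binary B [] = 0" "binary B [v] = 0" "binary B [v, w] = B v w" "binary B (u # v # w # ws) = 0"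
  by (simp_all add: binary_def)

lemma binary_length: "length vs \<noteq> 2 \<Longrightarrow> binary B vs = 0"
  by (auto simp: binary_def split: list.splits)

context twisted_space
begin

lemma twist_zero: "\<gamma> 0 = 0"
  using twist_add[of 0 0] by simp

lemma binary_cochain:
  assumes "\<And>x y z. B (x + y) z = B x z + B y z" "\<And>x y z. B z (x + y) = B z x + B z y"
    and "\<And>c x z. B (scale c x) z = scale c (B x z)" "\<And>c x z. B z (scale c x) = scale c (B z x)"
    and "\<And>x. B x x = 0" and "\<And>x y. \<gamma> (B x y) = B (\<gamma> x) (\<gamma> y)"
  shows "binary B \<in> cochains (Suc 0)"
proof -
  have *: "as = [] \<and> (\<exists>z. bs = [z]) \<or> (\<exists>z. as = [z]) \<and> bs = [] \<or> Suc (length as + length bs) \<noteq> 2"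
    for as bs :: "'v list"
    by (cases as rule: remdups_adj.cases; cases bs rule: remdups_adj.cases) auto
  have slot: "binary B (as @ x # bs) = 0" if "Suc (length as + length bs) \<noteq> 2" for as x bs
    using that by (intro binary_length) auto
  have "binary B (as @ (x + y) # bs) = binary B (as @ x # bs) + binary B (as @ y # bs)" for as x y bs
    using *[of as bs] by (elim disjE) (auto simp: assms slot)
  moreover have "binary B (as @ scale c x # bs) = scale c (binary B (as @ x # bs))" for as c x bs
    using *[of as bs] by (elim disjE) (auto simp: assms slot)
  moreover have "binary B (as @ x # x # bs) = 0" for as x bs
    by (cases "as = [] \<and> bs = []") (auto simp: assms intro!: binary_length)
  moreover have "\<gamma> (binary B hs) = binary B (map \<gamma> hs)" for hs
    by (auto simp: binary_def assms twist_zero split: list.splits)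
  ultimately show ?thesis
    by (simp add: cochains_iff binary_length)
qed

lemma circ_binary:
  "circ \<gamma> (binary B) (binary B') [u, v, w]
    = binary B [B' u v, \<gamma> w] - binary B [B' u w, \<gamma> v] + binary B [B' v w, \<gamma> u]"
  by (simp add: circ_def)

lemma length_3_cases: "length vs = Suc (Suc (Suc 0)) \<Longrightarrow> \<exists>u v w. vs = [u, v, w]"
  by (auto simp: length_Suc_conv)

text \<open>
  For binary cochains the Nijenhuis-Richardson bracket is a ternary cochain, the polarized
  Hom-Jacobiator; degrees \<open>1\<close> and \<open>1\<close> turn the graded commutator into a sum.
\<close>

lemma nr_bracket_binary_eq_zero:
  assumes "binary B \<in> cochains (Suc 0)" and "binary B' \<in> cochains (Suc 0)"
    and "\<And>u v w. B (B' u v) (\<gamma> w) - B (B' u w) (\<gamma> v) + B (B' v w) (\<gamma> u)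
      + (B' (B u v) (\<gamma> w) - B' (B u w) (\<gamma> v) + B' (B v w) (\<gamma> u)) = 0"
  shows "nr_bracket (Suc 0) (Suc 0) (binary B) (binary B') = 0"
proof
  fix vs :: "'v list"
  show "nr_bracket (Suc 0) (Suc 0) (binary B) (binary B') vs = 0 vs"
  proof (cases "length vs = Suc (Suc (Suc 0))")
    case True
    then obtain u v w where "vs = [u, v, w]" using length_3_cases by blast
    then show ?thesis
      using assms(3)[of u v w] by (simp add: nr_bracket_def circ_binary)
  next
    case False
    have "nr_bracket (Suc 0) (Suc 0) (binary B) (binary B') \<in> cochains (Suc 0 + Suc 0)"
      by (rule nr.br_closed) fact+
    from cochain_length[OF this, of vs] False show ?thesis by simp
  qed
qed

end

context hom_lie_algebra
begin

lemma bracket_add_left: "bracket (x + y) z = bracket x z + bracket y z"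
  and bracket_add_right: "bracket z (x + y) = bracket z x + bracket z y"
  and bracket_scale_left: "bracket (scale c x) z = scale c (bracket x z)"
  and bracket_scale_right: "bracket z (scale c x) = scale c (bracket z x)"
  using bilinear_bracket unfolding bilinear_map_def Vector_Spaces.linear_iff by blast+

lemma bracket_self: "bracket x x = 0"
proof -
  have "scale 2 (bracket x x) = bracket x x + bracket x x"
    using scale_left_distrib[of 1 1 "bracket x x"] by simp
  also have "\<dots> = 0" using skew[of x x] by (simp add: eq_neg_iff_add_eq_0)
  finally show ?thesis by simp
qed

lemma bracket_diff_left: "bracket (x - y) z = bracket x z - bracket y z"
  using bracket_add_left[of "x - y" y z] by simp

lemma bracket_zero_left: "bracket 0 x = 0" and bracket_zero_right: "bracket x 0 = 0"
  using bracket_add_left[of 0 0 x] bracket_add_right[of x 0 0] by simp_all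

lemma bracket_minus_right: "bracket z (- x) = - bracket z x"
  using bracket_add_right[of z x "- x"] by (simp add: bracket_zero_right add_eq_0_iff)

lemma hom_jacobi_right:
  "bracket (bracket x y) (\<alpha> z) - bracket (bracket x z) (\<alpha> y) + bracket (bracket y z) (\<alpha> x) = 0"
proof -
  have "bracket (bracket x z) (\<alpha> y) = bracket (\<alpha> y) (bracket z x)"
    using skew[of "bracket x z" "\<alpha> y"] skew[of x z] by (simp add: bracket_minus_right)
  moreover have "bracket (bracket x y) (\<alpha> z) = - bracket (\<alpha> z) (bracket x y)"
    and "bracket (bracket y z) (\<alpha> x) = - bracket (\<alpha> x) (bracket y z)" by (rule skew)+
  ultimately have "bracket (bracket x y) (\<alpha> z) - bracket (bracket x z) (\<alpha> y)
      + bracket (bracket y z) (\<alpha> x)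
    = - (bracket (\<alpha> x) (bracket y z) + bracket (\<alpha> y) (bracket z x) + bracket (\<alpha> z) (bracket x y))"
    by simp
  then show ?thesis unfolding hom_jacobi by simp
qed

lemma twist_add: "\<alpha> (x + y) = \<alpha> x + \<alpha> y" and twist_scale: "\<alpha> (scale c x) = scale c (\<alpha> x)"
  using linear_twist unfolding Vector_Spaces.linear_iff by blast+

lemma twist_zero: "\<alpha> 0 = 0"
  using twist_add[of 0 0] by simp

lemma twist_diff: "\<alpha> (x - y) = \<alpha> x - \<alpha> y"
  using twist_add[of "x - y" y] by simp

lemma twist_power_zero: "(\<alpha> ^^ k) 0 = 0"
  by (induction k) (simp_all add: twist_zero)

end

context hom_lie_action
begin

lemma act_add_left: "act (x + y) h = act x h + act y h"
  and act_add_right: "act x (h + k) = act x h + act x k"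
  and act_scale_left: "act (scaleG c x) h = scaleH c (act x h)"
  and act_scale_right: "act x (scaleH c h) = scaleH c (act x h)"
  using bilinear_act unfolding bilinear_map_def Vector_Spaces.linear_iff by blast+

lemma act_zero_left: "act 0 h = 0" and act_zero_right: "act x 0 = 0"
  using act_add_left[of 0 0 h] act_add_right[of x 0 0] by simp_all

lemma act_diff_right: "act x (h - k) = act x h - act x k"
  using act_add_right[of x "h - k" k] by simp

text \<open>On the direct sum both brackets and the action become binary cochains of the same kind.\<close>

definition scaleV :: "'k \<Rightarrow> 'g \<times> 'h \<Rightarrow> 'g \<times> 'h" where
  "scaleV c v = (scaleG c (fst v), scaleH c (snd v))"

definition twistV :: "'g \<times> 'h \<Rightarrow> 'g \<times> 'h" where
  "twistV v = (\<alpha> (fst v), \<beta> (snd v))"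

lemma vector_space_scaleV: "vector_space scaleV"
  by unfold_locales
    (auto simp: scaleV_def prod_eq_iff g.scale_right_distrib
        g.scale_left_distrib h.scale_right_distrib h.scale_left_distrib)

lemma linear_twistV: "Vector_Spaces.linear scaleV scaleV twistV"
  unfolding Vector_Spaces.linear_iff
  by (auto simp: vector_space_scaleV scaleV_def twistV_def prod_eq_iff g.twist_add h.twist_add
      g.twist_scale h.twist_scale)

sublocale V: twisted_space scaleV twistV
  by (intro twisted_space.intro twisted_space_axioms.intro vector_space_scaleV linear_twistV)

lemma fst_twistV_power: "fst ((twistV ^^ k) v) = (\<alpha> ^^ k) (fst v)"
  and snd_twistV_power: "snd ((twistV ^^ k) v) = (\<beta> ^^ k) (snd v)"
  by (induction k) (simp_all add: twistV_def)

text \<open>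
  The semidirect product of \<open>\<gg>\<close> with \<open>\<hh>\<close> regarded as an abelian algebra. The bracket of \<open>\<hh>\<close> is kept
  apart, in \<open>bracketV\<close>, because the first defines the Lie bracket on cochains and the second the
  differential.
\<close>

definition semidirect :: "('g \<times> 'h) list \<Rightarrow> 'g \<times> 'h" where
  "semidirect = binary (\<lambda>v w. (brG (fst v) (fst w), act (fst v) (snd w) - act (fst w) (snd v)))"

definition bracketV :: "'k \<Rightarrow> ('g \<times> 'h) list \<Rightarrow> 'g \<times> 'h" where
  "bracketV lam = binary (\<lambda>v w. (0, scaleH lam (brH (snd v) (snd w))))"

lemma semidirect_cochain: "semidirect \<in> V.cochains (Suc 0)"
  unfolding semidirect_def
  by (rule V.binary_cochain)
    (auto simp: prod_eq_iff scaleV_def twistV_def g.bracket_add_left g.bracket_add_right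
      g.bracket_scale_left g.bracket_scale_right g.bracket_self g.multiplicative act_twist[symmetric]
      h.twist_diff h.scale_right_diff_distrib
      act_add_left act_add_right act_scale_left act_scale_right)

lemma bracketV_cochain: "bracketV lam \<in> V.cochains (Suc 0)"
  unfolding bracketV_def
  by (rule V.binary_cochain)
    (auto simp: prod_eq_iff scaleV_def twistV_def h.bracket_add_left h.bracket_add_right
      h.bracket_scale_left h.bracket_scale_right h.bracket_self h.multiplicative h.twist_scale
      h.scale_right_distrib mult.commute g.twist_zero)

text \<open>The Hom-Jacobi identity of \<open>\<gg>\<close> and the representation axiom of the action.\<close>

lemma semidirect_square: "V.nr_bracket (Suc 0) (Suc 0) semidirect semidirect = 0"
  unfolding semidirect_def
proof (rule V.nr_bracket_binary_eq_zero, goal_cases)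
  case (3 u v w)
  show ?case
    using g.hom_jacobi_right
    by (simp add: prod_eq_iff twistV_def act_bracket act_add_right act_diff_right algebra_simps)
qed (fact semidirect_cochain[unfolded semidirect_def])+

lemma bracketV_square: "V.nr_bracket (Suc 0) (Suc 0) (bracketV lam) (bracketV lam) = 0"
  unfolding bracketV_def
proof (rule V.nr_bracket_binary_eq_zero, goal_cases)
  case (3 u v w)
  show ?case
    using h.hom_jacobi_right
    by (simp add: prod_eq_iff twistV_def h.bracket_scale_left
        flip: h.scale_right_distrib h.scale_right_diff_distrib)
qed (fact bracketV_cochain[unfolded bracketV_def])+

text \<open>The compatibility of the two structures is the derivation axiom of the action.\<close>

lemma bracketV_semidirect: "V.nr_bracket (Suc 0) (Suc 0) (bracketV lam) semidirect = 0"
  unfolding bracketV_def semidirect_def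
proof (rule V.nr_bracket_binary_eq_zero, goal_cases)
  case (3 u v w)
  have "act (\<alpha> x) (brH h k) + brH (act x k) (\<beta> h) - brH (act x h) (\<beta> k) = 0" for x h k
    using h.skew[of "\<beta> h" "act x k"] by (simp add: act_derivation)
  then have *: "act (\<alpha> x) (brH h k) = brH (act x h) (\<beta> k) - brH (act x k) (\<beta> h)" for x h k
    by (simp add: algebra_simps add_eq_0_iff)
  show ?case
    by (simp add: prod_eq_iff twistV_def * h.bracket_diff_left act_scale_right act_zero_left
        g.bracket_zero_left h.scale_right_diff_distrib algebra_simps)
qed (fact semidirect_cochain[unfolded semidirect_def] bracketV_cochain[unfolded bracketV_def])+

end

section \<open>Shuffle permutations\<close>

text \<open>
  The index \<open>0\<close> of a nonempty list is the value at \<open>0\<close> or at \<open>m\<close> of an \<open>(m, n)\<close>-shuffle, since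
  these are the smallest values of the two blocks. Deleting it leaves a shuffle of the tail. The
  inverse constructions are \<open>lift_perm\<close>, for a leading entry of the left block, and \<open>lift_perm\<close>
  preceded by the cycle \<open>to_front m\<close>, for a leading entry of the right block.
\<close>

definition lift_perm :: "(nat \<Rightarrow> nat) \<Rightarrow> nat \<Rightarrow> nat" where
  "lift_perm \<sigma> i = (case i of 0 \<Rightarrow> 0 | Suc j \<Rightarrow> Suc (\<sigma> j))"

lemma lift_perm_simps [simp]: "lift_perm \<sigma> 0 = 0" "lift_perm \<sigma> (Suc j) = Suc (\<sigma> j)"
  by (simp_all add: lift_perm_def)

lemma inj_lift_perm: "inj lift_perm"
  by (rule injI) (metis ext lift_perm_simps(2) nat.inject)

lemma lift_perm_eq: "\<tau> 0 = 0 \<Longrightarrow> inj \<tau> \<Longrightarrow> lift_perm (\<lambda>i. \<tau> (Suc i) - 1) = \<tau>"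
proof
  fix i
  assume "\<tau> 0 = 0" "inj \<tau>"
  then have "\<tau> (Suc j) \<noteq> 0" for j by (metis Zero_not_Suc injD)
  then show "lift_perm (\<lambda>i. \<tau> (Suc i) - 1) i = \<tau> i"
    using \<open>\<tau> 0 = 0\<close> by (cases i) simp_all
qed

lemma permutes_lift_perm_iff: "lift_perm \<sigma> permutes {..<Suc n} \<longleftrightarrow> \<sigma> permutes {..<n}"
proof
  assume L: "lift_perm \<sigma> permutes {..<Suc n}"
  have "bij \<sigma>"
  proof (rule bijI)
    show "inj \<sigma>"
      using permutes_inj[OF L] by (auto simp: inj_def) (metis lift_perm_simps(2) nat.inject)
    show "surj \<sigma>"
      unfolding surj_def
    proof
      fix y
      obtain i where "lift_perm \<sigma> i = Suc y"
        using permutes_surj[OF L] by (metis surjD)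
      then show "\<exists>x. y = \<sigma> x" by (cases i) auto
    qed
  qed
  moreover have "\<sigma> i = i" if "i \<notin> {..<n}" for i
    using permutes_not_in[OF L, of "Suc i"] that by simp
  ultimately show "\<sigma> permutes {..<n}"
    unfolding permutes_def by (metis bij_pointE)
next
  assume L: "\<sigma> permutes {..<n}"
  have "bij (lift_perm \<sigma>)"
  proof (rule bijI)
    show "inj (lift_perm \<sigma>)"
      using permutes_inj[OF L] by (intro injI) (auto simp: lift_perm_def dest: injD split: nat.splits)
    show "surj (lift_perm \<sigma>)"
      unfolding surj_def
    proof
      fix y
      show "\<exists>x. y = lift_perm \<sigma> x"
        using permutes_surj[OF L] by (cases y) (metis lift_perm_simps surjD)+
    qed
  qed
  moreover have "lift_perm \<sigma> i = i" if "i \<notin> {..<Suc n}" for i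
    using permutes_not_in[OF L] that by (cases i) auto
  ultimately show "lift_perm \<sigma> permutes {..<Suc n}"
    unfolding permutes_def by (metis bij_pointE)
qed

lemma sign_lift_perm:
  assumes "\<sigma> permutes {..<n}"
  shows "sign (lift_perm \<sigma>) = sign \<sigma>"
  using assms finite_lessThan
proof (induction rule: permutes_induct)
  case id
  have "lift_perm id = id" by (auto simp: lift_perm_def fun_eq_iff split: nat.splits)
  then show ?case by (simp only:)
next
  case (swap a b \<sigma>)
  have *: "lift_perm (transpose a b \<circ> \<sigma>) = transpose (Suc a) (Suc b) \<circ> lift_perm \<sigma>"
    by (auto simp: lift_perm_def fun_eq_iff transpose_def split: nat.splits)
  have perm: "permutation \<sigma>" "permutation (lift_perm \<sigma>)"
    using \<open>\<sigma> permutes {..<n}\<close> permutes_lift_perm_iff[of \<sigma> n] permutes_imp_permutation[OF finite_lessThan]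
    by blast+
  show ?case
    unfolding * sign_compose[OF permutation_swap_id perm(1)]
      sign_compose[OF permutation_swap_id perm(2)]
    using swap by (simp add: sign_swap_id)
qed

definition to_front :: "nat \<Rightarrow> nat \<Rightarrow> nat" where
  "to_front m i = (if i < m then Suc i else if i = m then 0 else i)"

lemma to_front_Suc: "to_front (Suc m) = to_front m \<circ> transpose m (Suc m)"
  by (auto simp: to_front_def fun_eq_iff transpose_def)

lemma to_front_permutes_sign: "to_front m permutes {..m} \<and> sign (to_front m) = (-1) ^ m"
proof (induction m)
  case 0
  have "to_front 0 = id" by (auto simp: to_front_def fun_eq_iff)
  then show ?case by (simp only: permutes_id sign_id power_0 simp_thms)
next
  case (Suc m)
  have "to_front m permutes {..Suc m}"
    using Suc by (meson atMost_subset_iff le_SucI order_refl permutes_subset)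
  moreover have "transpose m (Suc m) permutes {..Suc m}" by (intro permutes_swap_id) auto
  ultimately have "to_front (Suc m) permutes {..Suc m}"
    unfolding to_front_Suc by (intro permutes_compose)
  moreover have "sign (to_front (Suc m)) = sign (to_front m) * sign (transpose m (Suc m))"
    unfolding to_front_Suc using Suc
    by (intro sign_compose permutation_swap_id) (auto simp: permutation_permutes)
  then have "sign (to_front (Suc m)) = (-1) ^ Suc m"
    using Suc by (simp add: sign_swap_id)
  ultimately show ?case by blast
qed

lemma strict_mono_on_Suc_less: "strict_mono_on {..<Suc m} f \<longleftrightarrow>
    strict_mono_on {..<m} (\<lambda>i. f (Suc i)) \<and> (\<forall>i<m. f 0 < f (Suc i))" for f :: "nat \<Rightarrow> nat"
proof -
  have "f i < f j" if "strict_mono_on {..<m} (\<lambda>i. f (Suc i))" "\<forall>i<m. f 0 < f (Suc i)"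
    "i < j" "j < Suc m" for i j
    using that by (cases i; cases j) (auto simp: strict_mono_on_def)
  then show ?thesis by (auto simp: strict_mono_on_def)
qed

lemma strict_mono_on_Suc_comp: "strict_mono_on A (\<lambda>i. Suc (\<sigma> i)) \<longleftrightarrow> strict_mono_on A \<sigma>"
  by (simp add: monotone_on_def)

lemma strict_mono_on_Suc_image:
  "strict_mono_on (Suc ` A) f \<longleftrightarrow> strict_mono_on A (\<lambda>i. f (Suc i))"
  unfolding monotone_on_def by simp

lemma strict_mono_on_insert_Suc_image:
  fixes \<sigma> :: "nat \<Rightarrow> nat"
  assumes "f m = 0" and "\<And>i. i \<in> A \<Longrightarrow> m \<le> i" and "\<And>i. i \<in> A \<Longrightarrow> f (Suc i) = Suc (\<sigma> i)"
  shows "strict_mono_on (insert m (Suc ` A)) f \<longleftrightarrow> strict_mono_on A \<sigma>"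
proof -
  have "\<not> Suc i < m" "m < Suc i" if "i \<in> A" for i
    using assms(2)[OF that] by auto
  then show ?thesis
    unfolding monotone_on_def by (simp add: assms(1,3))
qed

lemma shuffles_perm_zero_left:
  "\<sigma> \<in> shuffles_perm (Suc m) n \<and> \<sigma> 0 = 0 \<longleftrightarrow> \<sigma> \<in> lift_perm ` shuffles_perm m n"
proof -
  have *: "lift_perm \<sigma> \<in> shuffles_perm (Suc m) n \<longleftrightarrow> \<sigma> \<in> shuffles_perm m n" for \<sigma>
  proof -
    have "strict_mono_on {Suc m..<Suc (m + n)} (lift_perm \<sigma>) \<longleftrightarrow> strict_mono_on {m..<m + n} \<sigma>"
    proof -
      have e: "{Suc m..<Suc (m + n)} = Suc ` {m..<m + n}" by simp
      show ?thesis
        unfolding e strict_mono_on_Suc_image by (simp add: strict_mono_on_Suc_comp)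
    qed
    then show ?thesis
      by (auto simp: shuffles_perm_def strict_mono_on_Suc_less strict_mono_on_Suc_comp permutes_lift_perm_iff cong: conj_cong)
  qed
  show ?thesis
  proof
    assume A: "\<sigma> \<in> shuffles_perm (Suc m) n \<and> \<sigma> 0 = 0"
    then have "lift_perm (\<lambda>i. \<sigma> (Suc i) - 1) = \<sigma>"
      by (intro lift_perm_eq) (auto simp: shuffles_perm_def dest: permutes_inj)
    then show "\<sigma> \<in> lift_perm ` shuffles_perm m n"
      using A * by (metis imageI)
  qed (auto simp: *)
qed

lemma shuffles_perm_zero_right:
  "\<sigma> \<in> shuffles_perm m (Suc n) \<and> \<sigma> m = 0 \<longleftrightarrow> \<sigma> \<in> (\<lambda>\<sigma>. lift_perm \<sigma> \<circ> to_front m) ` shuffles_perm m n"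
proof -
  have pf: "to_front m permutes {..<Suc (m + n)}"
    using to_front_permutes_sign[of m] by (rule permutes_subset[OF conjunct1]) auto
  have *: "lift_perm \<sigma> \<circ> to_front m \<in> shuffles_perm m (Suc n) \<longleftrightarrow> \<sigma> \<in> shuffles_perm m n" for \<sigma>
  proof -
    have "lift_perm \<sigma> \<circ> to_front m permutes {..<m + Suc n} \<longleftrightarrow> lift_perm \<sigma> permutes {..<Suc (m + n)}"
    proof
      assume "lift_perm \<sigma> \<circ> to_front m permutes {..<m + Suc n}"
      then have "(lift_perm \<sigma> \<circ> to_front m) \<circ> inv (to_front m) permutes {..<Suc (m + n)}"
        using permutes_compose[OF permutes_inv[OF pf]] by simp
      then show "lift_perm \<sigma> permutes {..<Suc (m + n)}"
        using permutes_inv_o(1)[OF pf] by (simp add: comp_assoc)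
    qed (use permutes_compose[OF pf] in simp)
    moreover have "strict_mono_on {..<m} (lift_perm \<sigma> \<circ> to_front m) \<longleftrightarrow> strict_mono_on {..<m} \<sigma>"
      by (auto simp: strict_mono_on_def to_front_def)
    moreover have "strict_mono_on {m..<m + Suc n} (lift_perm \<sigma> \<circ> to_front m)
      \<longleftrightarrow> strict_mono_on {m..<m + n} \<sigma>"
    proof -
      have e: "{m..<m + Suc n} = insert m (Suc ` {m..<m + n})"
        unfolding image_Suc_atLeastLessThan by auto
      show ?thesis
        unfolding e by (rule strict_mono_on_insert_Suc_image) (auto simp: to_front_def)
    qed
    ultimately show ?thesis by (simp add: shuffles_perm_def permutes_lift_perm_iff)
  qed
  show ?thesis
  proof
    assume A: "\<sigma> \<in> shuffles_perm m (Suc n) \<and> \<sigma> m = 0"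
    let ?t = "\<sigma> \<circ> inv (to_front m)"
    have "to_front m m = 0" by (simp add: to_front_def)
    then have "?t 0 = 0" using A permutes_inverses(2)[OF pf, of m] by simp
    moreover have "inj ?t"
      using A permutes_inj[OF permutes_inv[OF pf]]
      by (intro inj_compose) (auto simp: shuffles_perm_def dest: permutes_inj)
    ultimately have "lift_perm (\<lambda>i. ?t (Suc i) - 1) = ?t" by (rule lift_perm_eq)
    then have "lift_perm (\<lambda>i. ?t (Suc i) - 1) \<circ> to_front m = \<sigma>"
      using permutes_inv_o(2)[OF pf] by (simp add: comp_assoc)
    then show "\<sigma> \<in> (\<lambda>\<sigma>. lift_perm \<sigma> \<circ> to_front m) ` shuffles_perm m n"
      using A * by (metis (no_types, lifting) imageI)
  qed (auto simp: * to_front_def)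
qed

lemma shuffles_perm_cases:
  assumes "\<sigma> \<in> shuffles_perm m n" "0 < m + n"
  shows "0 < m \<and> \<sigma> 0 = 0 \<or> 0 < n \<and> \<sigma> m = 0"
proof -
  have s: "\<sigma> permutes {..<m + n}" "strict_mono_on {..<m} \<sigma>" "strict_mono_on {m..<m + n} \<sigma>"
    using assms by (auto simp: shuffles_perm_def)
  obtain i where i: "\<sigma> i = 0" using permutes_surj[OF s(1)] by (metis surjD)
  have "i < m + n" using permutes_not_in[OF s(1), of i] i assms(2) by (cases "i < m + n") auto
  show ?thesis
  proof (cases "i < m")
    case True
    then show ?thesis
      using i s(2) strict_mono_onD[OF s(2), of 0 i] by (cases i) auto
  next
    case False
    then show ?thesis
      using i \<open>i < m + n\<close> strict_mono_onD[OF s(3), of m i] by (cases "i = m") auto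
  qed
qed

lemma finite_shuffles_perm: "finite (shuffles_perm m n)"
  by (rule finite_subset[OF _ finite_permutations[of "{..<m + n}"]]) (auto simp: shuffles_perm_def)

text \<open>
  The recursion of \<open>unshuffle_sum\<close> matches the decomposition of the shuffles by the position of the
  index \<open>0\<close>. The sign \<open>(-1)\<^bsup>m\<^esup>\<close> of the cycle \<open>to_front m\<close> is the sign of moving the first entry past
  the left block.
\<close>

lemma sum_shuffles_perm_eq_unshuffle_sum:
  fixes F :: "'a list \<Rightarrow> 'a list \<Rightarrow> 'v::ab_group_add"
    and s :: "'k::field \<Rightarrow> 'v \<Rightarrow> 'v"
  assumes "vector_space s" and "length hs = m + n"
  shows "(\<Sum>\<sigma>\<in>shuffles_perm m n. s (of_int (sign \<sigma>))
      (F (map (\<lambda>i. hs ! \<sigma> i) [0..<m]) (map (\<lambda>i. hs ! \<sigma> i) [m..<m + n])))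
    = unshuffle_sum hs (\<lambda>a b. if length a = m then F a b else 0)"
  using assms(2)
proof (induction hs arbitrary: m n F)
  interpret s: vector_space s by fact
  case Nil
  have "shuffles_perm 0 0 = {id}"
    by (auto simp: shuffles_perm_def strict_mono_on_def permutes_id)
  with Nil show ?case by simp
next
  interpret s: vector_space s by fact
  case (Cons x xs)
  let ?T = "\<lambda>m n F xs. \<lambda>\<sigma>. s (of_int (sign \<sigma>))
      (F (map (\<lambda>i. xs ! \<sigma> i) [0..<m]) (map (\<lambda>i. xs ! \<sigma> i) [m..<m + n]))"
  let ?A = "{\<sigma> \<in> shuffles_perm m n. 0 < m \<and> \<sigma> 0 = 0}"
  let ?B = "{\<sigma> \<in> shuffles_perm m n. 0 < n \<and> \<sigma> m = 0}"
  have pos: "0 < m + n" using Cons.prems by (metis length_greater_0_conv list.distinct(1))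
  have "shuffles_perm m n = ?A \<union> ?B"
    using shuffles_perm_cases[OF _ pos] by blast
  moreover have "?A \<inter> ?B = {}"
  proof -
    have False if "\<sigma> \<in> shuffles_perm m n" "0 < m" "\<sigma> 0 = 0" "\<sigma> m = 0" for \<sigma>
      using that injD[OF permutes_inj[of \<sigma> "{..<m + n}"], of 0 m] by (simp add: shuffles_perm_def)
    then show ?thesis by auto
  qed
  ultimately have split: "sum (?T m n F (x # xs)) (shuffles_perm m n)
      = sum (?T m n F (x # xs)) ?A + sum (?T m n F (x # xs)) ?B"
    using finite_shuffles_perm[of m n]
    by (metis (no_types, lifting) finite_Un sum.union_disjoint)
  have A: "sum (?T m n F (x # xs)) ?A
      = unshuffle_sum xs (\<lambda>a b. if length (x # a) = m then F (x # a) b else 0)"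
  proof (cases m)
    case (Suc m')
    have "?A = lift_perm ` shuffles_perm m' n"
      using shuffles_perm_zero_left[of _ m' n] Suc by auto
    then have "sum (?T m n F (x # xs)) ?A = (\<Sum>\<sigma>\<in>shuffles_perm m' n. ?T m n F (x # xs) (lift_perm \<sigma>))"
      using inj_lift_perm by (simp add: sum.reindex inj_on_subset)
    also have "\<dots> = sum (?T m' n (\<lambda>a. F (x # a)) xs) (shuffles_perm m' n)"
    proof (rule sum.cong)
      fix \<sigma> assume "\<sigma> \<in> shuffles_perm m' n"
      then have "sign (lift_perm \<sigma>) = sign \<sigma>"
        by (auto simp: shuffles_perm_def intro: sign_lift_perm)
      moreover have "map (\<lambda>i. (x # xs) ! lift_perm \<sigma> i) [0..<m] = x # map (\<lambda>i. xs ! \<sigma> i) [0..<m']"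
        unfolding Suc map_upt_Suc by simp
      moreover have "map (\<lambda>i. (x # xs) ! lift_perm \<sigma> i) [m..<m + n] = map (\<lambda>i. xs ! \<sigma> i) [m'..<m' + n]"
        unfolding Suc add_Suc map_Suc_upt[symmetric] map_map by (simp add: o_def)
      ultimately show "?T m n F (x # xs) (lift_perm \<sigma>) = ?T m' n (\<lambda>a. F (x # a)) xs \<sigma>"
        by simp
    qed simp
    also have "\<dots> = unshuffle_sum xs (\<lambda>a b. if length a = m' then F (x # a) b else 0)"
      using Cons.prems Suc by (intro Cons.IH) simp
    finally show ?thesis by (simp add: Suc)
  qed simp
  have B: "sum (?T m n F (x # xs)) ?B
      = unshuffle_sum xs (\<lambda>a b. signed (length a) (if length a = m then F a (x # b) else 0))"
  proof (cases n)
    case 0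
    have "unshuffle_sum xs (\<lambda>a b. signed (length a) (if length a = m then F a (x # b) else 0))
      = unshuffle_sum xs (\<lambda>a b. 0)"
      using Cons.prems 0 by (intro unshuffle_sum_cong) auto
    then show ?thesis by (simp add: 0)
  next
    case (Suc n')
    have pf: "to_front m permutes {..<Suc (m + n')}"
      using to_front_permutes_sign[of m] by (rule permutes_subset[OF conjunct1]) auto
    have "?B = (\<lambda>\<sigma>. lift_perm \<sigma> \<circ> to_front m) ` shuffles_perm m n'"
      using shuffles_perm_zero_right[of _ m n'] Suc by auto
    moreover have "inj (\<lambda>\<sigma>. lift_perm \<sigma> \<circ> to_front m)"
    proof (rule injI)
      fix \<sigma> \<tau> assume "lift_perm \<sigma> \<circ> to_front m = lift_perm \<tau> \<circ> to_front m"
      then have "lift_perm \<sigma> \<circ> (to_front m \<circ> inv (to_front m)) = lift_perm \<tau> \<circ> (to_front m \<circ> inv (to_front m))"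
        by (simp add: fun_eq_iff)
      then show "\<sigma> = \<tau>"
        using injD[OF inj_lift_perm] permutes_inv_o(1)[OF pf] by simp
    qed
    ultimately have "sum (?T m n F (x # xs)) ?B
      = (\<Sum>\<sigma>\<in>shuffles_perm m n'. ?T m n F (x # xs) (lift_perm \<sigma> \<circ> to_front m))"
      by (simp add: sum.reindex inj_on_subset)
    also have "\<dots> = sum (?T m n' (\<lambda>a b. signed m (F a (x # b))) xs) (shuffles_perm m n')"
    proof (rule sum.cong)
      fix \<sigma> assume "\<sigma> \<in> shuffles_perm m n'"
      then have \<sigma>: "\<sigma> permutes {..<m + n'}" by (simp add: shuffles_perm_def)
      have "sign (lift_perm \<sigma> \<circ> to_front m) = sign (lift_perm \<sigma>) * sign (to_front m)"
        using pf \<sigma> permutes_lift_perm_iff[of \<sigma> "m + n'"]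
        by (intro sign_compose) (auto simp: permutation_permutes)
      then have sg: "sign (lift_perm \<sigma> \<circ> to_front m) = sign \<sigma> * (-1) ^ m"
        using to_front_permutes_sign[of m] sign_lift_perm[OF \<sigma>] by simp
      have a: "map (\<lambda>i. (x # xs) ! (lift_perm \<sigma> \<circ> to_front m) i) [0..<m] = map (\<lambda>i. xs ! \<sigma> i) [0..<m]"
        by (rule nth_equalityI) (simp_all add: to_front_def)
      have b: "map (\<lambda>i. (x # xs) ! (lift_perm \<sigma> \<circ> to_front m) i) [m..<m + n]
          = x # map (\<lambda>i. xs ! \<sigma> i) [m..<m + n']"
      proof -
        have "[m..<m + n] = m # map Suc [m..<m + n']"
          by (simp add: Suc upt_conv_Cons map_Suc_upt)
        then show ?thesis by (auto simp: to_front_def)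
      qed
      show "?T m n F (x # xs) (lift_perm \<sigma> \<circ> to_front m) = ?T m n' (\<lambda>a b. signed m (F a (x # b))) xs \<sigma>"
        unfolding sg a b by (simp add: signed_def)
    qed simp
    also have "\<dots> = unshuffle_sum xs (\<lambda>a b. if length a = m then signed m (F a (x # b)) else 0)"
      using Cons.prems Suc by (intro Cons.IH) simp
    also have "\<dots> = unshuffle_sum xs (\<lambda>a b. signed (length a) (if length a = m then F a (x # b) else 0))"
      by (rule unshuffle_sum_cong) simp
    finally show ?thesis .
  qed
  show ?case unfolding split A B by simp
qed

section \<open>The cochain operations as unshuffle sums\<close>

lemma (in vector_space) scale_sign: "scale ((-1) ^ k) x = signed k x"
  by (simp add: signed_def minus_one_power_iff)

text \<open>
  When one of the two blocks has a prescribed small length, the unshuffle sum becomes a sum over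
  positions. The case distinctions extend the summand by zero to all other lengths.
\<close>

lemma unshuffle_sum_right_Nil:
  "unshuffle_sum xs (\<lambda>a b. case b of [] \<Rightarrow> F a | _ # _ \<Rightarrow> 0) = F xs"
  by (induction xs arbitrary: F) auto

lemma unshuffle_sum_left_Nil:
  "unshuffle_sum xs (\<lambda>a b. case a of [] \<Rightarrow> F b | _ # _ \<Rightarrow> 0) = F xs"
proof (induction xs arbitrary: F)
  case (Cons x xs)
  have *: "signed (length a) (case a of [] \<Rightarrow> F (x # b) | _ # _ \<Rightarrow> 0)
    = (case a of [] \<Rightarrow> F (x # b) | _ # _ \<Rightarrow> 0)" for a b
    by (cases a) auto
  show ?case by (simp add: * Cons.IH)
qed simp

lemma nths_Cons_simps:
  "nths (x # xs) (- {0}) = xs" "nths (x # xs) (- {Suc i}) = x # nths xs (- {i})"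
  "nths (x # xs) (- {0, Suc i}) = nths xs (- {i})"
  "nths (x # xs) (- {Suc i, Suc j}) = x # nths xs (- {i, j})"
  by (simp_all add: nths_Cons nths_all Compl_eq)

lemma unshuffle_sum_right_singleton:
  "unshuffle_sum hs (\<lambda>a b. case b of [h] \<Rightarrow> F a h | _ \<Rightarrow> 0)
   = (\<Sum>i<length hs. signed (length hs - 1 - i) (F (nths hs (- {i})) (hs ! i)))"
proof (induction hs arbitrary: F)
  case (Cons x xs)
  have "unshuffle_sum xs (\<lambda>a b. signed (length a) (case x # b of [h] \<Rightarrow> F a h | _ \<Rightarrow> 0))
    = unshuffle_sum xs (\<lambda>a b. case b of [] \<Rightarrow> signed (length a) (F a x) | _ # _ \<Rightarrow> 0)"
    by (intro unshuffle_sum_cong) (simp split: list.splits)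
  also have "\<dots> = signed (length xs) (F xs x)" by (rule unshuffle_sum_right_Nil)
  finally show ?case
    by (simp add: Cons.IH sum.lessThan_Suc_shift nths_Cons_simps add.commute
        del: sum.lessThan_Suc)
qed simp

lemma unshuffle_sum_left_singleton:
  "unshuffle_sum hs (\<lambda>a b. case a of [h] \<Rightarrow> F h b | _ \<Rightarrow> 0)
   = (\<Sum>i<length hs. signed i (F (hs ! i) (nths hs (- {i}))))"
proof (induction hs arbitrary: F)
  case (Cons x xs)
  have "unshuffle_sum xs (\<lambda>a b. case x # a of [h] \<Rightarrow> F h b | _ \<Rightarrow> 0) = F x xs"
    using unshuffle_sum_left_Nil[of xs "F x"] by simp
  moreover have "unshuffle_sum xs (\<lambda>a b. signed (length a) (case a of [h] \<Rightarrow> F h (x # b) | _ \<Rightarrow> 0))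
    = - unshuffle_sum xs (\<lambda>a b. case a of [h] \<Rightarrow> F h (x # b) | _ \<Rightarrow> 0)"
    unfolding unshuffle_sum_minus[symmetric]
    by (intro unshuffle_sum_cong) (auto split: list.splits)
  ultimately show ?case
    by (simp add: Cons.IH sum.lessThan_Suc_shift nths_Cons_simps sum_negf del: sum.lessThan_Suc)
qed simp

lemma unshuffle_sum_left_pair:
  "unshuffle_sum hs (\<lambda>a b. case a of [h, k] \<Rightarrow> F h k b | _ \<Rightarrow> 0)
   = (\<Sum>j<length hs. \<Sum>i<j. signed (i + j + 1) (F (hs ! i) (hs ! j) (nths hs (- {i, j}))))"
proof (induction hs arbitrary: F)
  case (Cons x xs)
  have "unshuffle_sum xs (\<lambda>a b. case x # a of [h, k] \<Rightarrow> F h k b | _ \<Rightarrow> 0)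
    = (\<Sum>j<length xs. signed j (F x (xs ! j) (nths xs (- {j}))))"
    using unshuffle_sum_left_singleton[of xs "F x"] by simp
  moreover have "unshuffle_sum xs (\<lambda>a b. signed (length a) (case a of [h, k] \<Rightarrow> F h k (x # b) | _ \<Rightarrow> 0))
    = unshuffle_sum xs (\<lambda>a b. case a of [h, k] \<Rightarrow> F h k (x # b) | _ \<Rightarrow> 0)"
    by (intro unshuffle_sum_cong) (auto split: list.splits)
  ultimately show ?case
    by (simp add: Cons.IH sum.lessThan_Suc_shift nths_Cons_simps sum.distrib del: sum.lessThan_Suc)
qed simp

context hom_lie_action
begin

abbreviation homC :: "nat \<Rightarrow> ('h list \<Rightarrow> 'g) set" where
  "homC p \<equiv> hom_cochains scaleH \<beta> scaleG \<alpha> (Suc p)"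

lemmas homC_iff = hom_cochains_Suc_iff[OF h.vector_space_axioms g.vector_space_axioms]

lemma homC_length: "P \<in> homC p \<Longrightarrow> length hs \<noteq> Suc p \<Longrightarrow> P hs = 0"
  and homC_twist: "P \<in> homC p \<Longrightarrow> \<alpha> (P hs) = P (map \<beta> hs)"
  by (simp_all add: homC_iff)

lemma homC_add: "P \<in> homC p \<Longrightarrow> P (as @ (x + y) # bs) = P (as @ x # bs) + P (as @ y # bs)"
  and homC_scale: "P \<in> homC p \<Longrightarrow> P (as @ scaleH c x # bs) = scaleG c (P (as @ x # bs))"
  by (simp_all add: homC_iff)

lemma homC_add_head: "P \<in> homC p \<Longrightarrow> P ((x + y) # bs) = P (x # bs) + P (y # bs)"
  and homC_scale_head: "P \<in> homC p \<Longrightarrow> P (scaleH c x # bs) = scaleG c (P (x # bs))"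
  using homC_add[of P p "[]"] homC_scale[of P p "[]"] by simp_all

lemma homC_zero: "P \<in> homC p \<Longrightarrow> P (as @ 0 # bs) = 0"
  using homC_add[of P p as 0 0 bs] by simp

lemma homC_zero_head: "P \<in> homC p \<Longrightarrow> P (0 # bs) = 0"
  using homC_zero[of P p "[]"] by simp

lemma homC_zero_second: "P \<in> homC p \<Longrightarrow> P (x # 0 # bs) = 0"
  using homC_zero[of P p "[x]"] by simp

lemma homC_minus_head: "P \<in> homC p \<Longrightarrow> P ((- x) # bs) = - P (x # bs)"
  using homC_add_head[of P p x "- x" bs] by (simp add: homC_zero_head add_eq_0_iff)

lemma homC_twist_power: "P \<in> homC p \<Longrightarrow> (\<alpha> ^^ k) (P hs) = P (map (\<beta> ^^ k) hs)"
  by (induction k arbitrary: hs) (simp_all add: homC_twist)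

text \<open>
  Extension by zero along \<open>V \<rightarrow> \<hh>\<close> and \<open>\<gg> \<rightarrow> V\<close>. It identifies the cochains from \<open>\<hh>\<close> to \<open>\<gg>\<close> with a
  graded subspace of the cochains on \<open>V\<close>.
\<close>

definition hat :: "('h list \<Rightarrow> 'g) \<Rightarrow> ('g \<times> 'h) list \<Rightarrow> 'g \<times> 'h" where
  "hat P vs = (P (map snd vs), 0)"

lemma fst_hat_Pair: "fst (hat P (map (Pair 0) hs)) = P hs"
  by (simp add: hat_def o_def)

lemma hat_eq_iff: "hat P = hat Q \<longleftrightarrow> P = Q"
proof
  assume *: "hat P = hat Q"
  show "P = Q"
  proof
    fix hs
    have "fst (hat P (map (Pair 0) hs)) = fst (hat Q (map (Pair 0) hs))"
      by (simp only: *)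
    then show "P hs = Q hs" by (simp only: fst_hat_Pair)
  qed
qed simp

lemma hat_add: "hat (P + Q) = hat P + hat Q"
  and hat_diff: "hat (P - Q) = hat P - hat Q"
  and hat_minus: "hat (- P) = - hat P"
  and hat_zero: "hat 0 = 0"
  and hat_scale: "hat (cochain_scale scaleG c P) = cochain_scale scaleV c (hat P)"
  by (auto simp: fun_eq_iff hat_def cochain_scale_def scaleV_def prod_eq_iff)

lemma hat_signed: "hat (signed k P) = signed k (hat P)"
  by (simp add: signed_def hat_minus)

lemma hat_cochain_iff: "hat P \<in> V.cochains p \<longleftrightarrow> P \<in> homC p"
proof
  assume H: "hat P \<in> V.cochains p"
  have P: "P hs = fst (hat P (map (Pair 0) hs))" for hs
    by (simp add: hat_def o_def)
  show "P \<in> homC p"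
    unfolding homC_iff
  proof (intro conjI allI impI)
    fix as x y bs c and hs :: "'h list"
    show "P hs = 0" if "length hs \<noteq> Suc p"
      using V.cochain_length[OF H, of "map (Pair 0) hs"] that P[of hs] by simp
    show "P (as @ (x + y) # bs) = P (as @ x # bs) + P (as @ y # bs)"
      using V.cochain_add[OF H, of "map (Pair 0) as" "(0, x)" "(0, y)" "map (Pair 0) bs"]
      by (simp add: hat_def o_def)
    show "P (as @ scaleH c x # bs) = scaleG c (P (as @ x # bs))"
      using V.cochain_scale[OF H, of "map (Pair 0) as" c "(0, x)" "map (Pair 0) bs"]
      by (simp add: hat_def o_def scaleV_def)
    show "P (as @ x # x # bs) = 0"
      using V.cochain_alt[OF H, of "map (Pair 0) as" "(0, x)" "map (Pair 0) bs"]
      by (simp add: hat_def o_def prod_eq_iff)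
    show "\<alpha> (P hs) = P (map \<beta> hs)"
      using V.cochain_twist[OF H, of "map (Pair 0) hs"]
      by (simp add: hat_def o_def twistV_def g.twist_zero)
  qed
next
  assume "P \<in> homC p"
  then show "hat P \<in> V.cochains p"
    by (auto simp: homC_iff V.cochains_iff hat_def prod_eq_iff scaleV_def twistV_def h.twist_zero o_def)
qed

text \<open>
  The sign is a matter of conventions: in the unshuffle sum the entry \<open>h\<^sub>i\<close> passes the \<open>n + 1 - i\<close> later
  ones, whereas \<open>\<theta>\<close> weights it with \<open>(-1)\<^bsup>n + i\<^esup>\<close>.
\<close>

lemma theta_eq:
  assumes P: "P \<in> homC p"
  shows "theta scaleH \<beta> act (Suc p) P hs
    = - unshuffle_sum hs (\<lambda>a b. case b of [h] \<Rightarrow> act (P a) ((\<beta> ^^ (length a - 1)) h) | _ \<Rightarrow> 0)"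
proof (cases "length hs = Suc p + 1")
  case True
  have "unshuffle_sum hs (\<lambda>a b. case b of [h] \<Rightarrow> act (P a) ((\<beta> ^^ (length a - 1)) h) | _ \<Rightarrow> 0)
    = unshuffle_sum hs (\<lambda>a b. case b of [h] \<Rightarrow> act (P a) ((\<beta> ^^ p) h) | _ \<Rightarrow> 0)"
    using True by (intro unshuffle_sum_cong) (auto split: list.splits)
  also have "\<dots> = (\<Sum>i<Suc p + 1. signed (Suc p - i) (act (P (nths hs (- {i}))) ((\<beta> ^^ p) (hs ! i))))"
    unfolding unshuffle_sum_right_singleton True by simp
  also have "\<dots> = - (\<Sum>i<Suc p + 1. signed (Suc p + (i + 1)) (act (P (nths hs (- {i}))) ((\<beta> ^^ p) (hs ! i))))"
    unfolding sum_negf[symmetric] by (rule sum.cong) (auto simp: signed_def)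
  finally show ?thesis
    unfolding theta_def h.scale_sign using True by (simp del: signed_Suc sum.lessThan_Suc)
next
  case False
  have "unshuffle_sum hs (\<lambda>a b. case b of [h] \<Rightarrow> act (P a) ((\<beta> ^^ (length a - 1)) h) | _ \<Rightarrow> 0)
    = unshuffle_sum hs (\<lambda>a b. 0)"
    using False by (intro unshuffle_sum_cong)
      (auto split: list.splits simp: homC_length[OF P] act_zero_left)
  then show ?thesis using False by (simp add: theta_def)
qed

lemma insertion_eq:
  assumes P: "P \<in> homC q" and f: "\<And>hs. length hs \<noteq> Suc k \<Longrightarrow> f hs = 0"
  shows "insertion scaleG \<beta> (Suc k) (Suc q) f P hs = circ \<beta> P f hs"
proof -
  let ?F = "\<lambda>a b. P (f a # map (\<beta> ^^ k) b)"
  have "circ \<beta> P f hs = unshuffle_sum hs (\<lambda>a b. if length a = Suc k then ?F a b else 0)"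
    unfolding circ_def by (intro unshuffle_sum_cong) (auto simp: f homC_zero_head[OF P])
  also have "\<dots> = insertion scaleG \<beta> (Suc k) (Suc q) f P hs"
  proof (cases "length hs = Suc k + q")
    case True
    then show ?thesis
      using sum_shuffles_perm_eq_unshuffle_sum[OF g.vector_space_axioms True, of ?F]
      by (simp add: insertion_def o_def)
  next
    case False
    then have "unshuffle_sum hs (\<lambda>a b. if length a = Suc k then ?F a b else 0)
      = unshuffle_sum hs (\<lambda>a b. 0)"
      by (intro unshuffle_sum_cong) (auto simp: homC_length[OF P])
    with False show ?thesis by (simp add: insertion_def)
  qed
  finally show ?thesis by simp
qed

lemma cup_bracket_eq:
  assumes P: "P \<in> homC p" and Q: "Q \<in> homC q"
  shows "cup_bracket scaleG brG \<alpha> (Suc p) (Suc q) P Q hs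
    = unshuffle_sum hs (\<lambda>a b. brG ((\<alpha> ^^ (length b - 1)) (P a)) ((\<alpha> ^^ (length a - 1)) (Q b)))"
    (is "_ = unshuffle_sum hs ?G")
proof -
  let ?F = "\<lambda>a b. brG ((\<alpha> ^^ q) (P a)) ((\<alpha> ^^ p) (Q b))"
  have "unshuffle_sum hs ?G = unshuffle_sum hs (\<lambda>a b. if length a = Suc p then ?F a b else 0)"
  proof (rule unshuffle_sum_cong)
    fix a b :: "'h list"
    show "?G a b = (if length a = Suc p then ?F a b else 0)"
      by (cases "length b = Suc q") (auto simp: homC_length[OF P] homC_length[OF Q]
          g.twist_power_zero g.bracket_zero_left g.bracket_zero_right)
  qed
  also have "\<dots> = cup_bracket scaleG brG \<alpha> (Suc p) (Suc q) P Q hs"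
  proof (cases "length hs = Suc p + Suc q")
    case True
    then show ?thesis
      using sum_shuffles_perm_eq_unshuffle_sum[OF g.vector_space_axioms True, of ?F]
      by (simp add: cup_bracket_def)
  next
    case False
    then have "unshuffle_sum hs (\<lambda>a b. if length a = Suc p then ?F a b else 0)
      = unshuffle_sum hs (\<lambda>a b. 0)"
      by (intro unshuffle_sum_cong) (auto simp: homC_length[OF Q]
          g.twist_power_zero g.bracket_zero_right)
    with False show ?thesis by (simp add: cup_bracket_def)
  qed
  finally show ?thesis by simp
qed

text \<open>
  Moving \<open>h\<^sub>i\<close> and \<open>h\<^sub>j\<close> to the front has sign \<open>(-1)\<^bsup>i + j - 1\<^esup>\<close>, opposite to the sign \<open>(-1)\<^bsup>i + j\<^esup>\<close> of the
  differential. The weight is moved into the argument so that it becomes part of the bracket of \<open>\<hh>\<close>.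
\<close>

lemma homogeneous_differential_eq:
  assumes f: "f \<in> homC p"
  shows "homogeneous_differential scaleG brH \<beta> lam (Suc p) f hs
    = - unshuffle_sum hs (\<lambda>a b. case a of [h, k] \<Rightarrow> f (scaleH lam (brH h k) # map \<beta> b) | _ \<Rightarrow> 0)"
proof (cases "length hs = Suc p + 1")
  case True
  have "unshuffle_sum hs (\<lambda>a b. case a of [h, k] \<Rightarrow> f (scaleH lam (brH h k) # map \<beta> b) | _ \<Rightarrow> 0)
    = (\<Sum>j<Suc p + 1. \<Sum>i<j. signed (i + j + 1)
        (scaleG lam (f (brH (hs ! i) (hs ! j) # map \<beta> (nths hs (- {i, j}))))))"
    unfolding unshuffle_sum_left_pair True by (simp only: homC_scale_head[OF f])
  also have "\<dots> = - scaleG lam (\<Sum>j<Suc p + 1. \<Sum>i<j. signed (i + 1 + (j + 1))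
        (f (brH (hs ! i) (hs ! j) # map \<beta> (nths hs (- {i, j})))))"
    unfolding sum_negf[symmetric] g.scale_sum_right g.scale_minus_right[symmetric]
    by (intro sum.cong refl) (auto simp: signed_def)
  finally show ?thesis
    unfolding homogeneous_differential_def g.scale_sign using True
    by (simp del: signed_Suc sum.lessThan_Suc)
next
  case False
  have "unshuffle_sum hs (\<lambda>a b. case a of [h, k] \<Rightarrow> f (scaleH lam (brH h k) # map \<beta> b) | _ \<Rightarrow> 0)
    = unshuffle_sum hs (\<lambda>a b. 0)"
    using False by (intro unshuffle_sum_cong) (auto split: list.splits simp: homC_length[OF f])
  then show ?thesis using False by (simp add: homogeneous_differential_def)
qed

end

lemma signed_apply: "signed k f x = signed k (f x)"
  by (simp add: signed_def)

section \<open>The derived bracket of extended cochains\<close>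

lemma unshuffle_sum_fst: "fst (unshuffle_sum xs F) = unshuffle_sum xs (\<lambda>a b. fst (F a b))"
  and unshuffle_sum_snd: "snd (unshuffle_sum xs F) = unshuffle_sum xs (\<lambda>a b. snd (F a b))"
  by (rule unshuffle_sum_additive; simp)+

context twisted_space
begin

lemma nr_bracket_scale_left:
  assumes "g \<in> cochains q"
  shows "nr_bracket p q (cochain_scale scale c f) g = cochain_scale scale c (nr_bracket p q f g)"
  unfolding nr_bracket_def circ_scale_left circ_scale_right[OF assms]
  by (simp add: fun_eq_iff signed_def cochain_scale_def scale_right_diff_distrib
      scale_right_distrib)

lemma nr_bracket_scale_right:
  assumes "f \<in> cochains p"
  shows "nr_bracket p q f (cochain_scale scale c g) = cochain_scale scale c (nr_bracket p q f g)"
  unfolding nr_bracket_def circ_scale_left circ_scale_right[OF assms]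
  by (simp add: fun_eq_iff signed_def cochain_scale_def scale_right_diff_distrib
      scale_right_distrib)

lemma cochain_scale_signed:
  fixes f :: "'v list \<Rightarrow> 'v"
  shows "cochain_scale scale c (signed k f) = signed k (cochain_scale scale c f)"
  by (simp add: signed_def cochain_scale_def fun_eq_iff)

end

context hom_lie_action
begin

lemma circ_hat:
  assumes "\<And>vs. snd (f vs) = F (map snd vs)"
  shows "circ twistV (hat P) f = hat (circ \<beta> P F)"
  by (auto simp: fun_eq_iff prod_eq_iff hat_def circ_def unshuffle_sum_fst unshuffle_sum_snd
      unshuffle_sum_map assms snd_twistV_power o_def)

text \<open>
  An extended cochain only sees the \<open>\<hh>\<close>-components of its arguments. In particular extended cochains
  cannot be inserted into one another.
\<close>

lemma circ_hat_eq_zero: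
  assumes "P \<in> homC p" "\<And>vs. snd (f vs) = 0"
  shows "circ twistV (hat P) f = 0"
proof -
  have "circ twistV (hat P) f = hat (circ \<beta> P (\<lambda>_. 0))"
    by (rule circ_hat) (rule assms(2))
  also have "circ \<beta> P (\<lambda>_. 0) = 0"
    by (simp add: circ_def fun_eq_iff homC_zero_head[OF assms(1)])
  finally show ?thesis unfolding hat_zero .
qed

lemma snd_circ_hat: "snd (circ twistV (hat P) f vs) = 0"
  by (simp add: circ_def unshuffle_sum_snd hat_def)

text \<open>
  The \<open>\<hh>\<close>-component of \<open>\<pi>(P, \<cdot>)\<close> is the action of the values of \<open>P\<close>; the other half of the semidirect
  product pairs with the vanishing \<open>\<hh>\<close>-component of \<open>P\<close>.
\<close>

lemma snd_circ_semidirect: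
  assumes P: "P \<in> homC p"
  shows "snd (circ twistV semidirect (hat P) vs) = - theta scaleH \<beta> act (Suc p) P (map snd vs)"
proof -
  have "snd (semidirect (hat P a # map (twistV ^^ k) b))
    = (case map snd b of [h] \<Rightarrow> act (P (map snd a)) ((\<beta> ^^ k) h) | _ \<Rightarrow> 0)" for a b k
    by (auto simp: semidirect_def hat_def act_zero_right snd_twistV_power split: list.splits)
  then show ?thesis
    by (simp add: theta_eq[OF P] circ_def unshuffle_sum_snd unshuffle_sum_map)
qed

lemma circ_assoc_hat_eq_zero:
  assumes P: "P \<in> homC p"
  shows "V.circ_assoc (hat P) f (hat Q) = 0"
proof
  fix vs
  have "hat P (u # (twistV ^^ k) (hat Q a) # ws) = 0" for u k a ws
    using homC_zero_second[OF P]
    by (simp add: hat_def snd_twistV_power h.twist_power_zero prod_eq_iff)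
  then show "V.circ_assoc (hat P) f (hat Q) vs = 0 vs"
    by (simp add: V.circ_assoc_def)
qed

text \<open>
  Both arguments of \<open>\<pi>\<close> are values of extended cochains, so they lie in \<open>\<gg>\<close> and \<open>\<pi>\<close> is the bracket of
  \<open>\<gg>\<close>; nothing may be left over for further arguments. In the associator the arguments of \<open>Q\<close>
  precede those of \<open>P\<close>, and interchanging the blocks accounts for the sign.
\<close>

lemma circ_assoc_semidirect:
  assumes P: "P \<in> homC p" and Q: "Q \<in> homC q"
  shows "V.circ_assoc semidirect (hat P) (hat Q)
    = signed (Suc p * q) (hat (cup_bracket scaleG brG \<alpha> (Suc p) (Suc q) P Q))"
proof
  fix vs
  let ?F = "\<lambda>a c. (brG ((\<alpha> ^^ (length a - 1)) (P (map snd c))) ((\<alpha> ^^ (length c - 1)) (Q (map snd a))), 0::'h)"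
  have *: "hat P (map (twistV ^^ k) c) = ((\<alpha> ^^ k) (P (map snd c)), 0)" for k c
    using homC_twist_power[OF P, of k "map snd c"]
    by (simp add: hat_def o_def snd_twistV_power)
  have **: "(twistV ^^ k) (hat Q a) = ((\<alpha> ^^ k) (Q (map snd a)), 0)" for k a
    by (simp add: prod_eq_iff fst_twistV_power snd_twistV_power hat_def h.twist_power_zero)
  have "V.circ_assoc semidirect (hat P) (hat Q) vs
    = unshuffle_sum vs (\<lambda>u d. case d of [] \<Rightarrow> unshuffle_sum u (\<lambda>a c. signed (length c) (?F a c)) | _ # _ \<Rightarrow> 0)"
    unfolding V.circ_assoc_def
    by (intro unshuffle_sum_cong)
      (auto simp: * ** semidirect_def act_zero_right split: list.splits)
  also have "\<dots> = unshuffle_sum vs (\<lambda>a c. signed (length c) (?F a c))"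
    by (rule unshuffle_sum_right_Nil)
  also have "\<dots> = unshuffle_sum vs (\<lambda>a b. signed (length a * length b) (signed (length a) (?F b a)))"
    by (rule unshuffle_sum_commute)
  also have "\<dots> = unshuffle_sum vs (\<lambda>a b. signed (Suc p * q) (?F b a))"
  proof (rule unshuffle_sum_cong)
    fix a b :: "('g \<times> 'h) list"
    show "signed (length a * length b) (signed (length a) (?F b a)) = signed (Suc p * q) (?F b a)"
    proof (cases "length a = Suc p \<and> length b = Suc q")
      case True
      then show ?thesis by (auto simp: signed_def)
    next
      case False
      then have "?F b a = 0"
        by (auto simp: homC_length[OF P] homC_length[OF Q] prod_eq_iff
          g.twist_power_zero g.bracket_zero_left g.bracket_zero_right)
      then show ?thesis by simp
    qed
  qed
  also have "\<dots> = signed (Suc p * q) (hat (cup_bracket scaleG brG \<alpha> (Suc p) (Suc q) P Q) vs)"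
    unfolding unshuffle_sum_signed
    by (rule arg_cong[where f = "signed (Suc p * q)"]) (simp add: prod_eq_iff hat_def cup_bracket_eq[OF P Q] unshuffle_sum_fst unshuffle_sum_snd
        unshuffle_sum_map)
  finally show "V.circ_assoc semidirect (hat P) (hat Q) vs
    = signed (Suc p * q) (hat (cup_bracket scaleG brG \<alpha> (Suc p) (Suc q) P Q)) vs"
    by (simp only: signed_apply)
qed

abbreviation hom_derived_bracket ::
  "nat \<Rightarrow> nat \<Rightarrow> ('h list \<Rightarrow> 'g) \<Rightarrow> ('h list \<Rightarrow> 'g) \<Rightarrow> 'h list \<Rightarrow> 'g" where
  "hom_derived_bracket \<equiv> homogeneous_derived_bracket scaleG brG \<alpha> scaleH \<beta> act"

abbreviation hom_differential :: "'k \<Rightarrow> nat \<Rightarrow> ('h list \<Rightarrow> 'g) \<Rightarrow> 'h list \<Rightarrow> 'g" where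
  "hom_differential lam \<equiv> homogeneous_differential scaleG brH \<beta> lam"

lemma theta_length: "length hs \<noteq> Suc n \<Longrightarrow> theta scaleH \<beta> act n P hs = 0"
  by (simp add: theta_def)

lemma circ_uminus_right: "Q \<in> homC q \<Longrightarrow> circ \<beta> Q (\<lambda>hs. - f hs) = - circ \<beta> Q f"
  by (simp add: circ_def fun_eq_iff homC_minus_head unshuffle_sum_minus)

text \<open>
  Of the four composites in \<open>[[\<pi>, P], Q]\<close>, \<open>(\<pi> \<circ> P) \<circ> Q\<close> reduces to its associator, the cup product
  bracket, and \<open>(P \<circ> \<pi>) \<circ> Q\<close> to \<open>P \<circ> (\<pi> \<circ> Q)\<close>, an insertion of \<open>\<theta>Q\<close>; \<open>Q \<circ> (\<pi> \<circ> P)\<close> is an insertion of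
  \<open>\<theta>P\<close>; and \<open>Q \<circ> (P \<circ> \<pi>)\<close> vanishes.
\<close>

lemma derived_hat:
  assumes P: "P \<in> homC p" and Q: "Q \<in> homC q"
  shows "V.nr.derived semidirect p q (hat P) (hat Q) = hat (hom_derived_bracket (Suc p) (Suc q) P Q)"
proof -
  note P' = hat_cochain_iff[of P p, THEN iffD2, OF P] and Q' = hat_cochain_iff[of Q q, THEN iffD2, OF Q]
  let ?tP = "theta scaleH \<beta> act (Suc p) P" and ?tQ = "theta scaleH \<beta> act (Suc q) Q"
  have ins: "circ \<beta> Q ?tP = insertion scaleG \<beta> (Suc p + 1) (Suc q) ?tP Q"
    "circ \<beta> P ?tQ = insertion scaleG \<beta> (Suc q + 1) (Suc p) ?tQ P"
    using insertion_eq[OF Q, of "Suc p" ?tP] insertion_eq[OF P, of "Suc q" ?tQ]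
    by (auto simp: fun_eq_iff theta_length)
  have PQ: "circ twistV semidirect (circ twistV (hat P) (hat Q)) = 0"
    using circ_hat_eq_zero[OF P, of "hat Q"] V.circ_diff_right[OF semidirect_cochain, of 0 0]
    by (simp add: hat_def)
  have 1: "circ twistV (circ twistV semidirect (hat P)) (hat Q)
     = signed (Suc p * q) (hat (cup_bracket scaleG brG \<alpha> (Suc p) (Suc q) P Q))"
    unfolding V.circ_circ[OF semidirect_cochain P' Q'] PQ circ_assoc_semidirect[OF P Q] by simp
  have theta: "circ twistV (hat P') (circ twistV semidirect (hat Q'))
      = - hat (circ \<beta> P' (theta scaleH \<beta> act (Suc q') Q'))" if "P' \<in> homC p'" "Q' \<in> homC q'" for P' Q' p' q'
    using circ_hat[of "circ twistV semidirect (hat Q')" "\<lambda>hs. - theta scaleH \<beta> act (Suc q') Q' hs" P']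
      snd_circ_semidirect[OF that(2)] circ_uminus_right[OF that(1)] by (simp add: hat_minus)
  have 2: "circ twistV (circ twistV (hat P) semidirect) (hat Q) = - hat (circ \<beta> P ?tQ)"
    unfolding V.circ_circ[OF P' semidirect_cochain Q'] circ_assoc_hat_eq_zero[OF P] theta[OF P Q] by simp
  have 3: "circ twistV (hat Q) (circ twistV semidirect (hat P)) = - hat (circ \<beta> Q ?tP)"
    by (rule theta[OF Q P])
  have 4: "circ twistV (hat Q) (circ twistV (hat P) semidirect) = 0"
    by (rule circ_hat_eq_zero[OF Q]) (rule snd_circ_hat)
  show ?thesis
    unfolding V.nr.derived_def V.nr_bracket_def V.circ_diff_left V.circ_diff_right[OF Q']
      V.circ_signed_left V.circ_signed_right[OF Q'] 1 2 3 4 ins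
      homogeneous_derived_bracket_def hat_add hat_diff hat_scale
    by (auto simp: fun_eq_iff signed_def cochain_scale_def V.scale_sign)
qed

text \<open>
  The composite \<open>\<mu> \<circ> f\<close> vanishes because \<open>\<mu>\<close> only sees \<open>\<hh>\<close>-components, so \<open>[\<mu>, f]\<close> is the single term
  \<open>-(-1)\<^bsup>p\<^esup> f \<circ> \<mu>\<close>.
\<close>

lemma codifferential_hat:
  assumes f: "f \<in> homC p"
  shows "V.nr.codifferential (bracketV lam) p (hat f) = hat (hom_differential lam (Suc p) f)"
proof -
  note f' = hat_cochain_iff[of f p, THEN iffD2, OF f]
  have "bracketV lam (hat f a # ws) = 0" for a ws
    by (cases ws rule: remdups_adj.cases)
      (simp_all add: bracketV_def hat_def h.bracket_zero_left zero_prod_def)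
  then have 1: "circ twistV (bracketV lam) (hat f) = 0"
    by (simp add: circ_def fun_eq_iff)
  have "circ twistV (hat f) (bracketV lam)
    = hat (circ \<beta> f (\<lambda>hs. case hs of [h, k] \<Rightarrow> scaleH lam (brH h k) | _ \<Rightarrow> 0))"
    by (rule circ_hat) (auto simp: bracketV_def binary_def split: list.splits)
  also have "circ \<beta> f (\<lambda>hs. case hs of [h, k] \<Rightarrow> scaleH lam (brH h k) | _ \<Rightarrow> 0)
    = - hom_differential lam (Suc p) f"
    unfolding fun_eq_iff circ_def
    by (auto simp: homogeneous_differential_eq[OF f] homC_zero_head[OF f]
        intro!: unshuffle_sum_cong split: list.splits)
  finally have 2: "circ twistV (hat f) (bracketV lam) = - hat (hom_differential lam (Suc p) f)"
    unfolding hat_minus .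
  show ?thesis
    unfolding V.nr.codifferential_def V.nr_bracket_def 1 2 by (simp add: signed_def)
qed

text \<open>
  The following identities are transported from cochains on \<open>V\<close>: both sides are extended by zero,
  which is injective and reflects being a cochain.
\<close>

lemma homC_zero_mem: "0 \<in> homC p"
  and homC_add_mem: "P \<in> homC p \<Longrightarrow> Q \<in> homC p \<Longrightarrow> P + Q \<in> homC p"
  and homC_scale_mem: "P \<in> homC p \<Longrightarrow> cochain_scale scaleG c P \<in> homC p"
  unfolding hat_cochain_iff[symmetric] hat_zero hat_add hat_scale
  by (auto intro: V.cochains_zero V.cochains_add V.cochains_scale)

lemma hom_derived_bracket_closed:
  "P \<in> homC p \<Longrightarrow> Q \<in> homC q \<Longrightarrow> hom_derived_bracket (Suc p) (Suc q) P Q \<in> homC (Suc (p + q))"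
  using V.nr.derived_closed[OF semidirect_cochain, of "hat P" p "hat Q" q]
  by (simp add: derived_hat hat_cochain_iff)

lemma hom_derived_bracket_skew:
  assumes P: "P \<in> homC p" and Q: "Q \<in> homC q"
  shows "hom_derived_bracket (Suc p) (Suc q) P Q
    = - signed (Suc p * Suc q) (hom_derived_bracket (Suc q) (Suc p) Q P)"
proof -
  have "V.nr_bracket p q (hat P) (hat Q) = 0"
    using circ_hat_eq_zero[OF P, of "hat Q"] circ_hat_eq_zero[OF Q, of "hat P"]
    by (simp add: V.nr_bracket_def hat_def)
  from V.nr.derived_skew[OF semidirect_cochain _ _ this] show ?thesis
    by (simp only: P Q hat_cochain_iff derived_hat flip: hat_signed hat_minus hat_eq_iff)
qed

lemma hom_derived_bracket_jacobi:
  assumes P: "P \<in> homC p" and Q: "Q \<in> homC q" and R: "R \<in> homC r"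
  shows "hom_derived_bracket (Suc p) (Suc (Suc (q + r))) P (hom_derived_bracket (Suc q) (Suc r) Q R)
    = hom_derived_bracket (Suc (Suc (p + q))) (Suc r) (hom_derived_bracket (Suc p) (Suc q) P Q) R
      + signed (Suc p * Suc q)
         (hom_derived_bracket (Suc q) (Suc (Suc (p + r))) Q (hom_derived_bracket (Suc p) (Suc r) P R))"
  using V.nr.derived_jacobi[OF semidirect_cochain semidirect_square, of "hat P" p "hat Q" q "hat R" r]
  by (simp only: P Q R hat_cochain_iff derived_hat hom_derived_bracket_closed hat_eq_iff
      flip: hat_signed hat_add)

lemma hom_derived_bracket_add_left:
  assumes P: "P \<in> homC p" "P' \<in> homC p" and Q: "Q \<in> homC q"
  shows "hom_derived_bracket (Suc p) (Suc q) (P + P') Q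
    = hom_derived_bracket (Suc p) (Suc q) P Q + hom_derived_bracket (Suc p) (Suc q) P' Q"
proof -
  have "V.nr.derived semidirect p q (hat (P + P')) (hat Q)
    = V.nr.derived semidirect p q (hat P) (hat Q) + V.nr.derived semidirect p q (hat P') (hat Q)"
    using P Q unfolding V.nr.derived_def hat_add signed_add[symmetric]
    by (simp add: V.nr.br_add_right[OF semidirect_cochain] V.nr.br_add_left
        V.nr.ad_closed[OF semidirect_cochain] hat_cochain_iff)
  then show ?thesis
    by (simp only: P Q derived_hat homC_add_mem flip: hat_add hat_eq_iff)
qed

lemma hom_derived_bracket_add_right:
  assumes P: "P \<in> homC p" and Q: "Q \<in> homC q" "Q' \<in> homC q"
  shows "hom_derived_bracket (Suc p) (Suc q) P (Q + Q')
    = hom_derived_bracket (Suc p) (Suc q) P Q + hom_derived_bracket (Suc p) (Suc q) P Q'"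
proof -
  have "V.nr.derived semidirect p q (hat P) (hat (Q + Q'))
    = V.nr.derived semidirect p q (hat P) (hat Q) + V.nr.derived semidirect p q (hat P) (hat Q')"
    using P Q unfolding V.nr.derived_def hat_add signed_add[symmetric]
    by (simp add: V.nr.br_add_right[OF V.nr.ad_closed[OF semidirect_cochain]] hat_cochain_iff)
  then show ?thesis
    by (simp only: P Q derived_hat homC_add_mem flip: hat_add hat_eq_iff)
qed

lemma hom_derived_bracket_scale:
  assumes P: "P \<in> homC p" and Q: "Q \<in> homC q"
  shows "hom_derived_bracket (Suc p) (Suc q) (cochain_scale scaleG c P) Q
    = cochain_scale scaleG c (hom_derived_bracket (Suc p) (Suc q) P Q)"
    and "hom_derived_bracket (Suc p) (Suc q) P (cochain_scale scaleG c Q)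
    = cochain_scale scaleG c (hom_derived_bracket (Suc p) (Suc q) P Q)"
proof -
  have "V.nr.derived semidirect p q (hat (cochain_scale scaleG c P)) (hat Q)
      = cochain_scale scaleV c (V.nr.derived semidirect p q (hat P) (hat Q))"
    and "V.nr.derived semidirect p q (hat P) (hat (cochain_scale scaleG c Q))
      = cochain_scale scaleV c (V.nr.derived semidirect p q (hat P) (hat Q))"
    using P Q unfolding V.nr.derived_def hat_scale V.cochain_scale_signed
    by (simp_all add: V.nr_bracket_scale_right[OF semidirect_cochain] V.nr_bracket_scale_left
        V.nr_bracket_scale_right[OF V.nr.ad_closed[OF semidirect_cochain]] hat_cochain_iff)
  then show "hom_derived_bracket (Suc p) (Suc q) (cochain_scale scaleG c P) Q
    = cochain_scale scaleG c (hom_derived_bracket (Suc p) (Suc q) P Q)"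
    and "hom_derived_bracket (Suc p) (Suc q) P (cochain_scale scaleG c Q)
    = cochain_scale scaleG c (hom_derived_bracket (Suc p) (Suc q) P Q)"
    by (simp_all only: P Q derived_hat homC_scale_mem flip: hat_scale hat_eq_iff)
qed

lemma hom_differential_closed: "f \<in> homC p \<Longrightarrow> hom_differential lam (Suc p) f \<in> homC (Suc p)"
  using V.nr.ad_closed[OF bracketV_cochain, of "hat f" p] V.nr.signed_closed
  by (metis V.nr.codifferential_def codifferential_hat hat_cochain_iff)

lemma hom_differential_square:
  "f \<in> homC p \<Longrightarrow> hom_differential lam (Suc (Suc p)) (hom_differential lam (Suc p) f) = 0"
  using V.nr.codifferential_square[OF bracketV_cochain bracketV_square, of "hat f" p lam]
  by (simp add: hat_cochain_iff codifferential_hat hom_differential_closed hat_eq_iff flip: hat_zero)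

lemma hom_differential_derived_bracket:
  assumes P: "P \<in> homC p" and Q: "Q \<in> homC q"
  shows "hom_differential lam (Suc (Suc (p + q))) (hom_derived_bracket (Suc p) (Suc q) P Q)
    = hom_derived_bracket (Suc (Suc p)) (Suc q) (hom_differential lam (Suc p) P) Q
      + signed (Suc p) (hom_derived_bracket (Suc p) (Suc (Suc q)) P (hom_differential lam (Suc q) Q))"
  using V.nr.codifferential_derived[OF semidirect_cochain bracketV_cochain bracketV_semidirect,
      of "hat P" p "hat Q" q lam]
  by (simp only: P Q hat_cochain_iff derived_hat codifferential_hat hom_differential_closed
      hom_derived_bracket_closed hat_eq_iff flip: hat_signed hat_add)

lemma hom_differential_linear:
  assumes P: "P \<in> homC p" and Q: "Q \<in> homC p"
  shows "hom_differential lam (Suc p) (P + Q)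
      = hom_differential lam (Suc p) P + hom_differential lam (Suc p) Q"
    and "hom_differential lam (Suc p) (cochain_scale scaleG c P)
      = cochain_scale scaleG c (hom_differential lam (Suc p) P)"
proof -
  have "V.nr.codifferential (bracketV lam) p (hat (P + Q))
      = V.nr.codifferential (bracketV lam) p (hat P) + V.nr.codifferential (bracketV lam) p (hat Q)"
    and "V.nr.codifferential (bracketV lam) p (hat (cochain_scale scaleG c P))
      = cochain_scale scaleV c (V.nr.codifferential (bracketV lam) p (hat P))"
    using P Q unfolding V.nr.codifferential_def hat_add hat_scale signed_add[symmetric]
      V.cochain_scale_signed
    by (simp_all add: V.nr.br_add_right[OF bracketV_cochain]
        V.nr_bracket_scale_right[OF bracketV_cochain] hat_cochain_iff)
  then show "hom_differential lam (Suc p) (P + Q)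
      = hom_differential lam (Suc p) P + hom_differential lam (Suc p) Q"
    and "hom_differential lam (Suc p) (cochain_scale scaleG c P)
      = cochain_scale scaleG c (hom_differential lam (Suc p) P)"
    by (simp_all only: P Q codifferential_hat homC_add_mem homC_scale_mem
        flip: hat_add hat_scale hat_eq_iff)
qed

end

section \<open>The direct sum of all degrees\<close>

lemma degree_split: "m \<in> {1..<n} \<Longrightarrow> \<exists>i j. m = Suc i \<and> n - m = Suc j"
  by (cases m; cases "n - m") auto

lemma pred_eq_Suc: "2 \<le> n \<Longrightarrow> \<exists>p. n - 1 = Suc p"
  by (rule exI[of _ "n - 2"]) simp

lemma sum_fun_apply: "(\<Sum>n\<in>A. u n) x = (\<Sum>n\<in>A. u n x)"
  for u :: "'a \<Rightarrow> 'b \<Rightarrow> 'c::comm_monoid_add"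
  by (induction A rule: infinite_finite_induct) auto

lemma component_add: "component n (f + g) = component n f + component n g"
  for f g :: "'h list \<Rightarrow> 'g::ab_group_add"
  by (auto simp: component_def fun_eq_iff)

context hom_lie_action
begin

abbreviation homL :: "nat \<Rightarrow> ('h list \<Rightarrow> 'g) set" where
  "homL \<equiv> hom_cochains scaleH \<beta> scaleG \<alpha>"

abbreviation dbracket :: "('h list \<Rightarrow> 'g) \<Rightarrow> ('h list \<Rightarrow> 'g) \<Rightarrow> 'h list \<Rightarrow> 'g" where
  "dbracket \<equiv> derived_bracket scaleG brG \<alpha> scaleH \<beta> act"

abbreviation diffl :: "'k \<Rightarrow> ('h list \<Rightarrow> 'g) \<Rightarrow> 'h list \<Rightarrow> 'g" where
  "diffl lam \<equiv> differential scaleG brH \<beta> lam"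

lemma homL_0: "homL 0 = {0}"
  by (simp add: hom_cochains_def)

sublocale C: vector_space "cochain_scale scaleG :: 'k \<Rightarrow> ('h list \<Rightarrow> 'g) \<Rightarrow> 'h list \<Rightarrow> 'g"
  by unfold_locales
    (auto simp: cochain_scale_def fun_eq_iff g.scale_right_distrib g.scale_left_distrib)

lemma scale_sign_cochain: "cochain_scale scaleG ((-1) ^ k) f = signed k f"
  by (auto simp: cochain_scale_def g.scale_sign signed_def fun_eq_iff)

lemma subspace_homL: "C.subspace (homL n)"
proof (cases n)
  case 0
  then show ?thesis by (simp add: homL_0 C.subspace_single_0)
next
  case (Suc p)
  then show ?thesis
    by (auto intro!: C.subspaceI homC_zero_mem homC_add_mem homC_scale_mem)
qed

lemma component_homC:
  assumes "P \<in> homC p"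
  shows "component n P = (if n = Suc p then P else 0)"
  using homC_length[OF assms] by (auto simp: component_def fun_eq_iff)

lemma hom_derived_bracket_zero:
  "P \<in> homC p \<Longrightarrow> hom_derived_bracket (Suc p) (Suc q) P 0 = 0"
  "Q \<in> homC q \<Longrightarrow> hom_derived_bracket (Suc p) (Suc q) 0 Q = 0"
  using hom_derived_bracket_add_right[OF _ homC_zero_mem homC_zero_mem, of P p q]
    hom_derived_bracket_add_left[OF homC_zero_mem homC_zero_mem, of Q q p] by simp_all

lemma hom_differential_zero: "hom_differential lam (Suc p) 0 = 0"
  using hom_differential_linear(1)[OF homC_zero_mem homC_zero_mem, of lam p] by simp

text \<open>
  On homogeneous cochains the sum over pairs of components has a single nonzero term. On lists
  whose length is not the total arity there is none, and the right-hand side vanishes as well.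
\<close>

lemma derived_bracket_homogeneous:
  assumes P: "P \<in> homC p" and Q: "Q \<in> homC q"
  shows "dbracket P Q = hom_derived_bracket (Suc p) (Suc q) P Q"
proof
  fix hs
  let ?T = "\<lambda>m. hom_derived_bracket m (length hs - m) (component m P) (component (length hs - m) Q) hs"
  have zero: "?T m = 0" if m: "m \<in> {1..<length hs}" "\<not> (m = Suc p \<and> length hs - m = Suc q)" for m
  proof -
    obtain i j where ij: "m = Suc i" "length hs - m = Suc j"
      using degree_split[OF m(1)] by blast
    show ?thesis
      using m(2) hom_derived_bracket_zero(1)[OF P, of j] hom_derived_bracket_zero(2)[OF Q, of i]
        hom_derived_bracket_zero(1)[OF homC_zero_mem, of i j]
      unfolding ij(2) unfolding ij(1) component_homC[OF P] component_homC[OF Q] by auto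
  qed
  show "dbracket P Q hs = hom_derived_bracket (Suc p) (Suc q) P Q hs"
  proof (cases "length hs = Suc p + Suc q")
    case True
    then have "sum ?T {1..<length hs} = sum ?T {Suc p}"
      by (intro sum.mono_neutral_right ballI zero) auto
    then show ?thesis
      using True by (simp add: derived_bracket_def component_homC[OF P] component_homC[OF Q])
  next
    case False
    then have "sum ?T {1..<length hs} = 0"
      by (intro sum.neutral ballI zero) auto
    moreover have "hom_derived_bracket (Suc p) (Suc q) P Q hs = 0"
      using False homC_length[OF hom_derived_bracket_closed[OF P Q], of hs] by simp
    ultimately show ?thesis by (simp add: derived_bracket_def)
  qed
qed

lemma differential_homogeneous:
  assumes f: "f \<in> homC p"
  shows "diffl lam f = hom_differential lam (Suc p) f"
proof
  fix hs
  show "diffl lam f hs = hom_differential lam (Suc p) f hs"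
  proof (cases "length hs = Suc (Suc p)")
    case True
    then show ?thesis by (simp add: differential_def component_homC[OF f])
  next
    case False
    have "hom_differential lam (length hs - 1) (component (length hs - 1) f) hs = 0" if "2 \<le> length hs"
    proof -
      obtain i where "length hs - 1 = Suc i" using pred_eq_Suc[OF \<open>2 \<le> length hs\<close>] by blast
      then show ?thesis
        using False that by (auto simp: component_homC[OF f] hom_differential_zero)
    qed
    then show ?thesis
      using False homC_length[OF hom_differential_closed[OF f], of hs]
      by (simp add: differential_def)
  qed
qed

lemma derived_bracket_zero: "P \<in> homL n \<Longrightarrow> dbracket P 0 = 0 \<and> dbracket 0 P = 0"
proof (cases n)
  case 0
  assume "P \<in> homL n"
  with 0 show ?thesis
    using derived_bracket_homogeneous[OF homC_zero_mem[of 0] homC_zero_mem[of 0]]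
      hom_derived_bracket_zero(1)[OF homC_zero_mem] by (simp add: homL_0)
next
  case (Suc p)
  assume "P \<in> homL n"
  with Suc have "P \<in> homC p" by simp
  then show ?thesis
    using derived_bracket_homogeneous[OF homC_zero_mem[of 0]]
      derived_bracket_homogeneous[OF _ homC_zero_mem[of 0]] hom_derived_bracket_zero by auto
qed

lemma differential_zero: "diffl lam 0 = 0"
  using differential_homogeneous[OF homC_zero_mem] hom_differential_zero by simp

lemma component_scale:
  "component n (cochain_scale scaleG c f) = cochain_scale scaleG c (component n f)"
  for f :: "'h list \<Rightarrow> 'g"
  by (auto simp: component_def cochain_scale_def)

text \<open>
  Every element of the direct sum has cochains as its components, so that (bi)linearity can be
  checked degree by degree.
\<close>

lemma component_span:
  assumes "x \<in> C.span (\<Union>n. homL n)"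
  shows "component (Suc p) x \<in> homC p"
  using assms
proof (induction rule: C.span_induct)
  case (step x)
  then obtain n where n: "x \<in> homL n" by auto
  have "\<exists>q. x \<in> homC q"
    using n homC_zero_mem[of 0] by (cases n) (auto simp only: homL_0 singleton_iff)
  then obtain q where x: "x \<in> homC q" ..
  show ?case unfolding component_homC[OF x] using x homC_zero_mem[of p] by simp
next
  case base
  have zero: "component (Suc p) 0 = (0 :: 'h list \<Rightarrow> 'g)" by (auto simp: component_def)
  show ?case
    unfolding C.subspace_def mem_Collect_eq zero component_add component_scale
    using homC_zero_mem homC_add_mem homC_scale_mem by blast
qed

lemma derived_bracket_add:
  assumes x: "x \<in> C.span (\<Union>n. homL n)" and y: "y \<in> C.span (\<Union>n. homL n)"
    and z: "z \<in> C.span (\<Union>n. homL n)"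
  shows "dbracket (x + y) z = dbracket x z + dbracket y z"
    and "dbracket x (y + z) = dbracket x y + dbracket x z"
proof -
  note X = component_span[OF x] and Y = component_span[OF y] and Z = component_span[OF z]
  show "dbracket (x + y) z = dbracket x z + dbracket y z"
  proof
    fix hs
    have "hom_derived_bracket m (length hs - m) (component m (x + y)) (component (length hs - m) z) hs
        = hom_derived_bracket m (length hs - m) (component m x) (component (length hs - m) z) hs
          + hom_derived_bracket m (length hs - m) (component m y) (component (length hs - m) z) hs"
      if m: "m \<in> {1..<length hs}" for m
    proof -
      obtain i j where ij: "m = Suc i" "length hs - m = Suc j" using degree_split[OF m] by blast
      show ?thesis
        unfolding ij(2) unfolding ij(1) component_add hom_derived_bracket_add_left[OF X Y Z] by simp
    qed
    then show "dbracket (x + y) z hs = (dbracket x z + dbracket y z) hs"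
      by (simp only: plus_fun_apply derived_bracket_def flip: sum.distrib cong: sum.cong)
  qed
  show "dbracket x (y + z) = dbracket x y + dbracket x z"
  proof
    fix hs
    have "hom_derived_bracket m (length hs - m) (component m x) (component (length hs - m) (y + z)) hs
        = hom_derived_bracket m (length hs - m) (component m x) (component (length hs - m) y) hs
          + hom_derived_bracket m (length hs - m) (component m x) (component (length hs - m) z) hs"
      if m: "m \<in> {1..<length hs}" for m
    proof -
      obtain i j where ij: "m = Suc i" "length hs - m = Suc j" using degree_split[OF m] by blast
      show ?thesis
        unfolding ij(2) unfolding ij(1) component_add hom_derived_bracket_add_right[OF X Y Z] by simp
    qed
    then show "dbracket x (y + z) hs = (dbracket x y + dbracket x z) hs"
      by (simp only: plus_fun_apply derived_bracket_def flip: sum.distrib cong: sum.cong)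
  qed
qed

lemma derived_bracket_scale:
  assumes x: "x \<in> C.span (\<Union>n. homL n)" and y: "y \<in> C.span (\<Union>n. homL n)"
  shows "dbracket (cochain_scale scaleG c x) y = cochain_scale scaleG c (dbracket x y)"
    and "dbracket x (cochain_scale scaleG c y) = cochain_scale scaleG c (dbracket x y)"
proof -
  note X = component_span[OF x] and Y = component_span[OF y]
  have scale: "cochain_scale scaleG c (dbracket x y) hs = (\<Sum>m\<in>{1..<length hs}.
      cochain_scale scaleG c (hom_derived_bracket m (length hs - m)
        (component m x) (component (length hs - m) y)) hs)" for hs
    by (simp add: cochain_scale_def derived_bracket_def g.scale_sum_right)
  show "dbracket (cochain_scale scaleG c x) y = cochain_scale scaleG c (dbracket x y)"
  proof
    fix hs
    show "dbracket (cochain_scale scaleG c x) y hs = cochain_scale scaleG c (dbracket x y) hs"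
      unfolding scale unfolding derived_bracket_def
    proof (intro sum.cong refl)
      fix m assume "m \<in> {1..<length hs}"
      then obtain i j where ij: "m = Suc i" "length hs - m = Suc j" using degree_split by blast
      show "hom_derived_bracket m (length hs - m) (component m (cochain_scale scaleG c x))
          (component (length hs - m) y) hs
        = cochain_scale scaleG c (hom_derived_bracket m (length hs - m) (component m x)
            (component (length hs - m) y)) hs"
        unfolding ij(2) unfolding ij(1) component_scale hom_derived_bracket_scale[OF X Y] by simp
    qed
  qed
  show "dbracket x (cochain_scale scaleG c y) = cochain_scale scaleG c (dbracket x y)"
  proof
    fix hs
    show "dbracket x (cochain_scale scaleG c y) hs = cochain_scale scaleG c (dbracket x y) hs"
      unfolding scale unfolding derived_bracket_def
    proof (intro sum.cong refl)
      fix m assume "m \<in> {1..<length hs}"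
      then obtain i j where ij: "m = Suc i" "length hs - m = Suc j" using degree_split by blast
      show "hom_derived_bracket m (length hs - m) (component m x)
          (component (length hs - m) (cochain_scale scaleG c y)) hs
        = cochain_scale scaleG c (hom_derived_bracket m (length hs - m) (component m x)
            (component (length hs - m) y)) hs"
        unfolding ij(2) unfolding ij(1) component_scale hom_derived_bracket_scale[OF X Y] by simp
    qed
  qed
qed

lemma differential_add:
  assumes x: "x \<in> C.span (\<Union>n. homL n)" and y: "y \<in> C.span (\<Union>n. homL n)"
  shows "diffl lam (x + y) = diffl lam x + diffl lam y"
proof -
  note X = component_span[OF x] and Y = component_span[OF y]
  show "diffl lam (x + y) = diffl lam x + diffl lam y"
  proof
    fix hs
    show "diffl lam (x + y) hs = (diffl lam x + diffl lam y) hs"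
    proof (cases "2 \<le> length hs")
      case True
      from pred_eq_Suc[OF this] obtain p where p: "length hs - 1 = Suc p" by blast
      show ?thesis
        unfolding differential_def plus_fun_apply p component_add hom_differential_linear(1)[OF X Y]
        using True by simp
    qed (simp add: differential_def)
  qed
qed

lemma differential_scale:
  assumes x: "x \<in> C.span (\<Union>n. homL n)"
  shows "diffl lam (cochain_scale scaleG c x) = cochain_scale scaleG c (diffl lam x)"
proof -
  note X = component_span[OF x]
  show "diffl lam (cochain_scale scaleG c x) = cochain_scale scaleG c (diffl lam x)"
  proof
    fix hs
    show "diffl lam (cochain_scale scaleG c x) hs = cochain_scale scaleG c (diffl lam x) hs"
    proof (cases "2 \<le> length hs")
      case True
      from pred_eq_Suc[OF this] obtain p where p: "length hs - 1 = Suc p" by blast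
      show ?thesis
        unfolding differential_def p component_scale hom_differential_linear(2)[OF X X]
        using True p by (simp add: cochain_scale_def differential_def)
    qed (simp add: differential_def cochain_scale_def)
  qed
qed

lemma derived_bracket_degree:
  assumes "x \<in> homL m" "y \<in> homL n"
  shows "dbracket x y \<in> homL (m + n)"
proof (cases "m = 0 \<or> n = 0")
  case True
  with assms have "dbracket x y = 0" by (auto simp: homL_0 derived_bracket_zero)
  then show ?thesis using C.subspace_0[OF subspace_homL] by simp
next
  case False
  then obtain p q where "m = Suc p" "n = Suc q" by (metis not0_implies_Suc)
  with assms show ?thesis
    using hom_derived_bracket_closed[of x p y q] by (simp add: derived_bracket_homogeneous)
qed

lemma differential_degree: "x \<in> homL n \<Longrightarrow> diffl lam x \<in> homL (Suc n)"
  using C.subspace_0[OF subspace_homL, of "Suc 0"]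
  by (cases n) (auto simp: homL_0 differential_zero differential_homogeneous
    intro: hom_differential_closed)

text \<open>
  In positive degrees the axioms are the homogeneous identities of the previous section. Degree
  zero consists of the zero cochain only and is treated separately in each axiom.
\<close>

theorem dg_lie_algebra_cochains:
  "dg_lie_algebra (cochain_scale scaleG) homL dbracket (diffl lam)"
proof
  fix n m p :: nat and A :: "nat set" and u :: "nat \<Rightarrow> 'h list \<Rightarrow> 'g" and c :: 'k
    and x y z :: "'h list \<Rightarrow> 'g"
  show "C.subspace (homL n)" by (rule subspace_homL)
  show "\<forall>n\<in>A. u n = 0" if A: "finite A" "\<forall>n\<in>A. u n \<in> homL n" "(\<Sum>n\<in>A. u n) = 0"
  proof (intro ballI ext)
    fix n hs
    assume n: "n \<in> A"
    have len: "u m hs = 0" if "m \<in> A" "length hs \<noteq> m" for m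
      using A(2) that by (cases m) (auto simp: homL_0 homC_length)
    show "u n hs = 0 hs"
    proof (cases "length hs = n")
      case True
      have "(\<Sum>m\<in>A. u m hs) = u n hs"
        using A(1) n True by (subst sum.mono_neutral_right[of A "{n}"]) (auto intro: len)
      then show ?thesis using A(3) by (simp flip: sum_fun_apply)
    qed (use len n in auto)
  qed
  show "dbracket x y \<in> homL (m + n)" if "x \<in> homL m" "y \<in> homL n"
    using that by (rule derived_bracket_degree)
  show "dbracket x y = - cochain_scale scaleG ((-1) ^ (m * n)) (dbracket y x)"
    if "x \<in> homL m" "y \<in> homL n"
  proof (cases "m = 0 \<or> n = 0")
    case True
    with that show ?thesis by (auto simp: homL_0 derived_bracket_zero)
  next
    case False
    then obtain p q where "m = Suc p" "n = Suc q" by (metis not0_implies_Suc)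
    with that show ?thesis
      unfolding scale_sign_cochain
      using hom_derived_bracket_skew[of x p y q] by (simp only: derived_bracket_homogeneous)
  qed
  show "dbracket x (dbracket y z) = dbracket (dbracket x y) z
      + cochain_scale scaleG ((-1) ^ (m * n)) (dbracket y (dbracket x z))"
    if "x \<in> homL m" "y \<in> homL n" "z \<in> homL p"
  proof (cases "m = 0 \<or> n = 0 \<or> p = 0")
    case True
    moreover have "dbracket 0 0 = 0" using derived_bracket_zero[of 0 0] by (simp add: homL_0)
    moreover have "dbracket 0 (dbracket y z) = 0 \<and> dbracket (dbracket x y) 0 = 0
      \<and> dbracket 0 (dbracket x z) = 0"
      using that by (blast intro: derived_bracket_degree derived_bracket_zero[THEN conjunct1]
          derived_bracket_zero[THEN conjunct2])
    ultimately show ?thesis using that by (auto simp: homL_0 derived_bracket_zero)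
  next
    case False
    then obtain i j k where ijk: "m = Suc i" "n = Suc j" "p = Suc k" by (metis not0_implies_Suc)
    with that have x: "x \<in> homC i" and y: "y \<in> homC j" and z: "z \<in> homC k" by auto
    note xy = hom_derived_bracket_closed[OF x y] and yz = hom_derived_bracket_closed[OF y z]
      and xz = hom_derived_bracket_closed[OF x z]
    show ?thesis
      unfolding scale_sign_cochain derived_bracket_homogeneous[OF x y]
        derived_bracket_homogeneous[OF y z] derived_bracket_homogeneous[OF x z]
        derived_bracket_homogeneous[OF x yz] derived_bracket_homogeneous[OF xy z]
        derived_bracket_homogeneous[OF y xz] ijk
      by (rule hom_derived_bracket_jacobi[OF x y z])
  qed
  show "diffl lam x \<in> homL (Suc n)" if "x \<in> homL n"
    using that by (rule differential_degree)
  show "diffl lam (diffl lam x) = 0" if "x \<in> homL n"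
  proof (cases n)
    case 0
    with that show ?thesis by (simp only: homL_0 singleton_iff differential_zero)
  next
    case (Suc p)
    with that have x: "x \<in> homC p" by simp
    show ?thesis
      unfolding differential_homogeneous[OF x] differential_homogeneous[OF hom_differential_closed[OF x]]
      by (rule hom_differential_square[OF x])
  qed
  show "diffl lam (dbracket x y) = dbracket (diffl lam x) y
      + cochain_scale scaleG ((-1) ^ m) (dbracket x (diffl lam y))"
    if "x \<in> homL m" "y \<in> homL n"
  proof (cases "m = 0 \<or> n = 0")
    case True
    moreover have "dbracket 0 (diffl lam y) = 0 \<and> dbracket (diffl lam x) 0 = 0"
      using that by (blast intro: differential_degree derived_bracket_zero[THEN conjunct1]
          derived_bracket_zero[THEN conjunct2])
    ultimately show ?thesis using that by (auto simp: homL_0 derived_bracket_zero differential_zero)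
  next
    case False
    then obtain p q where pq: "m = Suc p" "n = Suc q" by (metis not0_implies_Suc)
    with that have x: "x \<in> homC p" and y: "y \<in> homC q" by auto
    note dx = hom_differential_closed[OF x] and dy = hom_differential_closed[OF y]
    show ?thesis
      unfolding scale_sign_cochain derived_bracket_homogeneous[OF x y]
        differential_homogeneous[OF x] differential_homogeneous[OF y]
        differential_homogeneous[OF hom_derived_bracket_closed[OF x y]]
        derived_bracket_homogeneous[OF dx y] derived_bracket_homogeneous[OF x dy] pq
      by (rule hom_differential_derived_bracket[OF x y])
  qed
qed (fact derived_bracket_add derived_bracket_scale differential_add differential_scale)+

text \<open>
  Skew-symmetry doubles every term of \<open>[R, R]\<close>, which the factor \<open>1/2\<close> undoes; linearity of \<open>R\<close>
  collects the remaining values of \<open>R\<close> into one.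
\<close>

theorem maurer_cartan_iff_rota_baxter:
  assumes R: "R \<in> homL 1"
  shows "maurer_cartan (cochain_scale scaleG) homL dbracket (diffl lam) R
    \<longleftrightarrow> relative_rota_baxter scaleG brG \<alpha> scaleH brH \<beta> act lam (\<lambda>h. R [h])"
proof -
  have R': "R \<in> homC 0" using R by simp
  have lin: "Vector_Spaces.linear scaleH scaleG (\<lambda>h. R [h])"
    unfolding Vector_Spaces.linear_iff
    using homC_add_head[OF R', of _ _ "[]"] homC_scale_head[OF R', of _ _ "[]"]
    by (simp add: h.vector_space_axioms g.vector_space_axioms)
  let ?D = "diffl lam R + cochain_scale scaleG (1/2) (dbracket R R)"
  have half: "scaleG (1/2) (x + x) = x" for x
    using g.scale_left_distrib[of 1 1 x] g.scale_scale[of "1/2" 2 x] by simp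
  \<comment> \<open>As a cochain of arity two, the left-hand side is determined by its values on pairs.\<close>
  have "?D \<in> homC (Suc 0)"
    unfolding derived_bracket_homogeneous[OF R' R'] differential_homogeneous[OF R']
    using hom_derived_bracket_closed[OF R' R'] hom_differential_closed[OF R']
    by (intro homC_add_mem homC_scale_mem) simp_all
  then have "?D = 0 \<longleftrightarrow> (\<forall>h k. ?D [h, k] = 0)"
    using homC_length[of ?D "Suc 0"]
    by (auto simp: fun_eq_iff length_Suc_conv) (metis length_0_conv length_Suc_conv)
  also have "\<dots> \<longleftrightarrow> (\<forall>h k. brG (R [h]) (R [k]) = R [act (R [h]) k - act (R [k]) h + scaleH lam (brH h k)])"
  proof (intro all_cong1)
    fix h k
    have d: "diffl lam R [h, k] = - R [scaleH lam (brH h k)]"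
      unfolding differential_homogeneous[OF R'] homogeneous_differential_eq[OF R'] by simp
    have t: "theta scaleH \<beta> act (Suc 0) R [h, k] = - (act (R [h]) k - act (R [k]) h)"
      unfolding theta_eq[OF R'] by simp
    have "insertion scaleG \<beta> (Suc (Suc 0)) (Suc 0) (theta scaleH \<beta> act (Suc 0) R) R [h, k]
        = R [- (act (R [h]) k - act (R [k]) h)]"
      by (subst insertion_eq[OF R'])
        (simp_all add: theta_length circ_def t homC_zero_head[OF R'])
    moreover have "cup_bracket scaleG brG \<alpha> (Suc 0) (Suc 0) R R [h, k]
        = brG (R [h]) (R [k]) + brG (R [h]) (R [k])"
      unfolding cup_bracket_eq[OF R' R'] using g.skew[of "R [k]" "R [h]"]
      by (simp add: homC_length[OF R'] g.bracket_zero_left g.bracket_zero_right)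
    ultimately have "dbracket R R [h, k] = (brG (R [h]) (R [k]) + R [- (act (R [h]) k - act (R [k]) h)])
        + (brG (R [h]) (R [k]) + R [- (act (R [h]) k - act (R [k]) h)])"
      unfolding derived_bracket_homogeneous[OF R' R'] homogeneous_derived_bracket_def
      by (simp add: cochain_scale_def)
    then have "?D [h, k] = brG (R [h]) (R [k])
        + R [- (act (R [h]) k - act (R [k]) h)] - R [scaleH lam (brH h k)]"
      by (simp only: plus_fun_apply cochain_scale_def half d) simp
    also have "\<dots> = brG (R [h]) (R [k]) - R [act (R [h]) k - act (R [k]) h + scaleH lam (brH h k)]"
      using homC_minus_head[OF R'] homC_add_head[OF R'] by (simp del: minus_diff_eq)
    finally show "?D [h, k] = 0 \<longleftrightarrow> brG (R [h]) (R [k])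
        = R [act (R [h]) k - act (R [k]) h + scaleH lam (brH h k)]"
      by simp
  qed
  finally show ?thesis
    using R lin homC_twist[OF R'] by (simp add: maurer_cartan_def relative_rota_baxter_def fun_eq_iff)
qed

end

theorem theorem5p11:
  fixes scaleG :: "'k::field_char_0 \<Rightarrow> 'g::ab_group_add \<Rightarrow> 'g"
    and brG :: "'g \<Rightarrow> 'g \<Rightarrow> 'g" and \<alpha> :: "'g \<Rightarrow> 'g"
    and scaleH :: "'k \<Rightarrow> 'h::ab_group_add \<Rightarrow> 'h"
    and brH :: "'h \<Rightarrow> 'h \<Rightarrow> 'h" and \<beta> :: "'h \<Rightarrow> 'h"
    and act :: "'g \<Rightarrow> 'h \<Rightarrow> 'h"
  assumes "hom_lie_algebra scaleG brG \<alpha>"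
    and "hom_lie_algebra scaleH brH \<beta>"
    and "hom_lie_action scaleG brG \<alpha> scaleH brH \<beta> act"
  shows "\<forall>lam :: 'k.
    dg_lie_algebra (cochain_scale scaleG) (hom_cochains scaleH \<beta> scaleG \<alpha>)
      (derived_bracket scaleG brG \<alpha> scaleH \<beta> act)
      (differential scaleG brH \<beta> lam) \<and>
    (\<forall>R \<in> hom_cochains scaleH \<beta> scaleG \<alpha> 1.
      maurer_cartan (cochain_scale scaleG) (hom_cochains scaleH \<beta> scaleG \<alpha>)
        (derived_bracket scaleG brG \<alpha> scaleH \<beta> act)
        (differential scaleG brH \<beta> lam) R
      \<longleftrightarrow> relative_rota_baxter scaleG brG \<alpha> scaleH brH \<beta> act lam (\<lambda>h. R [h]))"
proof -
  interpret hom_lie_action scaleG brG \<alpha> scaleH brH \<beta> act by fact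
  show ?thesis
    using dg_lie_algebra_cochains maurer_cartan_iff_rota_baxter by blast
qed

end
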